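(* Let $k\ge 2$ be an integer and let $\Phi$ be a constant-free bracket form of degree at most $k-1$. Then there is a constant $c>0$, depending only on $\Phi$, such that for every positive integer $N$ and every realisation $\phi$ of $\Phi$ (regarded as a function $[N]\to\mathbb{R}$), the function $f:[N]\to\mathbb{C}$, $f(n)=e(\phi(n))$, satisfies $\|f\|_{U^k[N]}\ge c$.
   Context: Notation: $e(x)=\exp(2\pi i x)$, $[N]=\{1,\dots,N\}$, and for $x\in\mathbb{R}$, $\{x\}$ denotes the fractional part of $x$ chosen to lie in $(-1/2,1/2]$ (so $x-\{x\}\in\mathbb{Z}$). Gowers norms: for a finite abelian group $G$ and $g:G\to\mathbb{C}$, write $\Delta^*_h g(x)=g(x+h)\overline{g(x)}$ and $\|g\|_{U^k(G)}=(\mathbb{E}_{x,h_1,\dots,h_k\in G}\Delta^*_{h_1}\cdots\Delta^*_{h_k}g(x))^{1/2^k}$. For $f:[N]\to\mathbb{C}$ fix an integer $\tilde N\ge 2^kN$, let $\tilde f:\mathbb{Z}/\tilde N\mathbb{Z}\to\mathbb{C}$ equal $f$ on $[N]$ and $0$ elsewhere, and set $\|f\|_{U^k[N]}=\|\tilde f\|_{U^k(\mathbb{Z}/\tilde N\mathbb{Z})}/\|1_{[N]}\|_{U^k(\mathbb{Z}/\tilde N\mathbb{Z})}$ (independent of the choice of $\tilde N$). Polynomial forms: fix an alphabet of symbols $\alpha_1,\alpha_2,\dots$. A monomial form is a formal expression $\pm\alpha_{i_1}\cdots\alpha_{i_t}n^j$ ($t\ge0$, $j\ge0$); it has degree $j$,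 and is constant-free if $j\ge1$. A polynomial form of degree at most $k$ is a formal finite sum of monomial forms of degree at most $k$; it is constant-free if all its monomial forms are. Bracket forms are formal expressions defined recursively: a polynomial form of degree at most $k$ is a bracket form of degree at most $k$; if $\Phi$ is a bracket form of degree at most $k$ then so are $-\Phi$ and $\{\Phi\}$; if $\Phi_1,\Phi_2$ are bracket forms of degree at most $k_1,k_2$ then $\Phi_1\cdot\Phi_2$ is a bracket form of degree at most $k_1+k_2$ and $\Phi_1+\Phi_2$ is a bracket form of degree at most $\max\{k_1,k_2\}$. A bracket form is constant-free if all polynomial forms used in its construction are constant-free. A realisation of a bracket form is the function of $n$ obtained by replacing each symbol $\alpha_i$ by a real number (the same real number for every occurrence of $\alpha_i$), where $\{\cdot\}$ is interpreted as the fractional part. *)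

theory Defs
  imports Complex_Main "HOL-Algebra.Elementary_Groups"
begin

definition e2pi :: "real \<Rightarrow> complex" where
  "e2pi x = exp (2 * complex_of_real pi * \<i> * complex_of_real x)"

definition sfrac :: "real \<Rightarrow> real" where
  "sfrac x = x - of_int \<lceil>x - 1 / 2\<rceil>"

lemma sfrac_char:
  "y = sfrac x \<longleftrightarrow> - 1 / 2 < y \<and> y \<le> 1 / 2 \<and> x - y \<in> \<int>"
proof
  assume "y = sfrac x"
  moreover have "- 1 / 2 < sfrac x" "sfrac x \<le> 1 / 2"
    unfolding sfrac_def by linarith+
  ultimately show "- 1 / 2 < y \<and> y \<le> 1 / 2 \<and> x - y \<in> \<int>"
    by (simp add: sfrac_def)
next
  assume y: "- 1 / 2 < y \<and> y \<le> 1 / 2 \<and> x - y \<in> \<int>"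
  then obtain m where "x - y = of_int m" by (auto elim: Ints_cases)
  moreover from this y have "\<lceil>x - 1 / 2\<rceil> = m"
    by (intro ceiling_unique) auto
  ultimately show "y = sfrac x" by (simp add: sfrac_def)
qed


text \<open>Gowers norms on a finite abelian group, written multiplicatively as in HOL-Algebra.\<close>

definition mult_deriv ::
    "('a, 'm) monoid_scheme \<Rightarrow> 'a \<Rightarrow> ('a \<Rightarrow> complex) \<Rightarrow> 'a \<Rightarrow> complex" where
  "mult_deriv G h g x = g (x \<otimes>\<^bsub>G\<^esub> h) * cnj (g x)"

text \<open>The list \<open>hs\<close> ranges over \<open>G\<^sup>k\<close>. For \<open>k \<ge> 1\<close> the average is a nonnegative real number,
  so taking its real part only changes the type.\<close>

definition gowers_norm ::
    "('a, 'm) monoid_scheme \<Rightarrow> nat \<Rightarrow> ('a \<Rightarrow> complex) \<Rightarrow> real" where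
  "gowers_norm G k g =
     root (2 ^ k)
       (Re ((\<Sum>x\<in>carrier G. \<Sum>hs\<in>{hs. set hs \<subseteq> carrier G \<and> length hs = k}.
               foldr (mult_deriv G) hs g x)
            / of_nat (card (carrier G)) ^ (k + 1)))"

text \<open>The carrier of \<^term>\<open>integer_mod_group M\<close> is \<open>{0..<M}\<close>, which contains \<open>[N]\<close> when \<open>N < M\<close>.\<close>

definition extend_zero :: "nat \<Rightarrow> (nat \<Rightarrow> complex) \<Rightarrow> int \<Rightarrow> complex" where
  "extend_zero N f r = (if 1 \<le> r \<and> r \<le> int N then f (nat r) else 0)"

text \<open>\<open>M\<close> is the auxiliary modulus, to be used with \<open>M \<ge> 2 ^ k * N\<close>; the value does not
  depend on the choice of such an \<open>M\<close>.\<close>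

definition gowers_norm_interval ::
    "nat \<Rightarrow> nat \<Rightarrow> nat \<Rightarrow> (nat \<Rightarrow> complex) \<Rightarrow> real" where
  "gowers_norm_interval M k N f =
     gowers_norm (integer_mod_group M) k (extend_zero N f) /
     gowers_norm (integer_mod_group M) k (extend_zero N (\<lambda>_. 1))"


text \<open>\<open>Monomial s is j\<close> is the formal expression \<open>\<plusminus>\<alpha>\<^bsub>i1\<^esub>\<dots>\<alpha>\<^bsub>it\<^esub> n\<^sup>j\<close> with \<open>is = [i1, \<dots>, it]\<close>,
  the sign being negative iff \<open>s\<close> holds.\<close>

datatype monomial_form = Monomial bool "nat list" (mono_degree: nat)

type_synonym polynomial_form = "monomial_form list"

datatype bracket_form =
    Poly polynomial_form
  | Neg bracket_form
  | Frac bracket_form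
  | Mult bracket_form bracket_form
  | Add bracket_form bracket_form

inductive degree_at_most :: "bracket_form \<Rightarrow> nat \<Rightarrow> bool" where
  "\<forall>m \<in> set p. mono_degree m \<le> k \<Longrightarrow> degree_at_most (Poly p) k"
| "degree_at_most \<Phi> k \<Longrightarrow> degree_at_most (Neg \<Phi>) k"
| "degree_at_most \<Phi> k \<Longrightarrow> degree_at_most (Frac \<Phi>) k"
| "degree_at_most \<Phi>1 k1 \<Longrightarrow> degree_at_most \<Phi>2 k2 \<Longrightarrow> degree_at_most (Mult \<Phi>1 \<Phi>2) (k1 + k2)"
| "degree_at_most \<Phi>1 k1 \<Longrightarrow> degree_at_most \<Phi>2 k2 \<Longrightarrow> degree_at_most (Add \<Phi>1 \<Phi>2) (max k1 k2)"

primrec constant_free :: "bracket_form \<Rightarrow> bool" where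
  "constant_free (Poly p) \<longleftrightarrow> (\<forall>m \<in> set p. mono_degree m \<ge> 1)"
| "constant_free (Neg \<Phi>) \<longleftrightarrow> constant_free \<Phi>"
| "constant_free (Frac \<Phi>) \<longleftrightarrow> constant_free \<Phi>"
| "constant_free (Mult \<Phi>1 \<Phi>2) \<longleftrightarrow> constant_free \<Phi>1 \<and> constant_free \<Phi>2"
| "constant_free (Add \<Phi>1 \<Phi>2) \<longleftrightarrow> constant_free \<Phi>1 \<and> constant_free \<Phi>2"

primrec realise_monomial :: "(nat \<Rightarrow> real) \<Rightarrow> monomial_form \<Rightarrow> nat \<Rightarrow> real" where
  "realise_monomial \<alpha> (Monomial s is j) n =
     (if s then - 1 else 1) * prod_list (map \<alpha> is) * real n ^ j"

primrec realise :: "(nat \<Rightarrow> real) \<Rightarrow> bracket_form \<Rightarrow> nat \<Rightarrow> real" where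
  "realise \<alpha> (Poly p) n = (\<Sum>m\<leftarrow>p. realise_monomial \<alpha> m n)"
| "realise \<alpha> (Neg \<Phi>) n = - realise \<alpha> \<Phi> n"
| "realise \<alpha> (Frac \<Phi>) n = sfrac (realise \<alpha> \<Phi> n)"
| "realise \<alpha> (Mult \<Phi>1 \<Phi>2) n = realise \<alpha> \<Phi>1 n * realise \<alpha> \<Phi>2 n"
| "realise \<alpha> (Add \<Phi>1 \<Phi>2) n = realise \<alpha> \<Phi>1 n + realise \<alpha> \<Phi>2 n"

end

theory Submission
  imports Defs "HOL-Analysis.Convex" "HOL-Library.FuncSet" "HOL-Library.Disjoint_Sets"
begin

text \<open>
  Let \<open>A\<close> be the set of \<open>n \<in> [N]\<close> at which every bracketed quantity occurring in \<open>\<Phi>\<close> has a very small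
  fractional part. If all vertices of a cube but one lie in \<open>A\<close>, then on this cube every
  bracket agrees with a polynomial in the cube coordinates: alternating sums of fractional parts
  over a face of dimension above the degree are integers smaller than 1 in absolute value, hence
  vanish. So \<open>\<phi>\<close> has degree at most \<open>k - 1\<close> on the cube, and the sum over cubes of \<open>f = e(\<phi>)\<close> at
  one vertex against \<open>f\<close> restricted to \<open>A\<close> at all the others just counts cubes. The
  Gowers-Cauchy-Schwarz inequality bounds this count by the norm of \<open>f\<close>, so it remains to see that
  \<open>A\<close> has positive density.

  For this, colour each multiple \<open>j m\<close> of \<open>m\<close> by the approximate values of all brackets and apply
  the finite unions theorem: there are multiples of \<open>m\<close>, by bounded factors, whose finite sums all
  have the same colour. These sums form a cube whose missing vertex is 0, where all
  brackets vanish because \<open>\<Phi>\<close> is constant-free, and the same integrality argument shows that the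
  common value of each bracket is close to 0. Hence every \<open>m\<close> has a bounded multiple in \<open>A\<close>.

  Uniformity in \<open>k\<close>: if \<open>S\<^sub>k\<close> is the sum over \<open>k\<close>-dimensional cubes and \<open>W = 2 N\<close>, Cauchy-Schwarz
  gives \<open>(S\<^sub>k / W\<^bsup>k+1\<^esup>)\<^sup>2 \<le> S\<^bsub>k+1\<^esub> / W\<^bsup>k+2\<^esup>\<close>, so a lower bound \<open>C\<close> for the smallest admissible \<open>k\<close> persists.
\<close>

section \<open>The finite unions theorem\<close>

text \<open>Induction on \<open>m\<close>: \<open>q\<close> further points are appended, and for
  each initial segment \<open>p j\<close> of them the colouring
  \<open>S \<mapsto> \<chi> (S \<union> p j)\<close> has an \<open>m\<close>-dimensional cube. By
  pigeonhole two segments yield the same data, and their difference serves as the new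
  direction.\<close>

lemma hilbert_cube_unions:
  fixes r m :: nat
  shows "\<exists>n. \<forall>\<chi> :: nat set \<Rightarrow> nat. (\<forall>S. \<chi> S < r) \<longrightarrow>
    (\<exists>A Z. A \<noteq> {} \<and> A \<subseteq> {..<n} \<and> (\<forall>i<m. Z i \<noteq> {} \<and> Z i \<subseteq> {..<n} \<and> Z i \<inter> A = {}) \<and>
      disjoint_family_on Z {..<m} \<and> (\<forall>I\<subseteq>{..<m}. \<chi> (A \<union> (\<Union>i\<in>I. Z i)) = \<chi> A))"
proof (induction m)
  case 0
  have "\<exists>A. A \<noteq> {} \<and> A \<subseteq> {..<Suc 0}" by auto
  then show ?case
    by (intro exI[of _ "Suc 0"]) (auto simp: disjoint_family_on_def)
next
  case (Suc m)
  define good where "good = (\<lambda>n (\<chi> :: nat set \<Rightarrow> nat) A Z. A \<noteq> {} \<and> A \<subseteq> {..<n} \<and>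
     (\<forall>i<m. Z i \<noteq> {} \<and> Z i \<subseteq> {..<n} \<and> Z i \<inter> A = {}) \<and>
      disjoint_family_on Z {..<m} \<and> (\<forall>I\<subseteq>{..<m}. \<chi> (A \<union> (\<Union>i\<in>I. Z i)) = \<chi> A))"
  from Suc obtain n where n: "\<And>\<chi>. (\<forall>S. \<chi> S < r) \<Longrightarrow> \<exists>A Z. good n \<chi> A Z"
    unfolding good_def by blast
  \<comment> \<open>The possible triples of base, directions and colour; \<open>q + 1\<close>
    segments therefore force a repetition. Directions are cut down to \<open>{..<m}\<close> so that
    this set is finite.\<close>
  define X where "X = Pow {..<n} \<times> ({..<m} \<rightarrow>\<^sub>E Pow {..<n}) \<times> {..<r}"
  have finX: "finite X" unfolding X_def by (auto intro!: finite_PiE)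
  define q where "q = card X"
  show ?case
  proof (intro exI[of _ "n + q"] allI impI)
    fix \<chi> :: "nat set \<Rightarrow> nat" assume chi: "\<forall>S. \<chi> S < r"
    define p where "p = (\<lambda>j. {n..<n+j})"
    have "\<forall>j. \<exists>A Z. good n (\<lambda>S. \<chi> (S \<union> p j)) A Z"
      using chi by (intro allI n) auto
    then obtain A Z where AZ: "\<And>j. good n (\<lambda>S. \<chi> (S \<union> p j)) (A j) (Z j)" by metis
    define F where "F = (\<lambda>j. (A j, restrict (Z j) {..<m}, \<chi> (A j \<union> p j)))"
    have "F ` {..q} \<subseteq> X"
    proof
      fix y assume "y \<in> F ` {..q}"
      then obtain j where y: "y = F j" by auto
      have "A j \<subseteq> {..<n}" "\<forall>i<m. Z j i \<subseteq> {..<n}" using AZ[of j] unfolding good_def by auto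
      then show "y \<in> X" unfolding y F_def X_def using chi by simp
    qed
    then have "card (F ` {..q}) \<le> q"
      unfolding q_def using finX by (rule card_mono[rotated])
    then have "\<not> inj_on F {..q}" by (intro pigeonhole) simp
    then obtain i j where ij: "i < j" "j \<le> q" "F i = F j"
      unfolding inj_on_def by (metis atMost_iff linorder_neqE_nat)
    have Aij: "A j = A i" and chij: "\<chi> (A i \<union> p j) = \<chi> (A i \<union> p i)"
      using ij(3) unfolding F_def by auto
    have Zij: "Z j l = Z i l" if "l < m" for l
    proof -
      have "restrict (Z i) {..<m} = restrict (Z j) {..<m}" using ij(3) unfolding F_def by simp
      then have "restrict (Z i) {..<m} l = restrict (Z j) {..<m} l" by simp
      then show ?thesis using that by simp
    qed
    define Y where "Y = (\<lambda>l. if l < m then Z i l else {n+i..<n+j})"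
    have gi: "good n (\<lambda>S. \<chi> (S \<union> p i)) (A i) (Z i)" and gj: "good n (\<lambda>S. \<chi> (S \<union> p j)) (A j) (Z j)"
      by (rule AZ)+
    have disj: "disjoint_family_on Y {..<Suc m}"
      unfolding disjoint_family_on_def
    proof (intro ballI impI)
      fix a b assume ab: "a \<in> {..<Suc m}" "b \<in> {..<Suc m}" "a \<noteq> b"
      have Z: "Z i l \<inter> {n+i..<n+j} = {}" if "l < m" for l
      proof -
        have "Z i l \<subseteq> {..<n}" using gi that unfolding good_def by auto
        then show ?thesis by force
      qed
      have "Z i a \<inter> Z i b = {}" if "a < m" "b < m"
        using gi that ab unfolding good_def disjoint_family_on_def by auto
      then show "Y a \<inter> Y b = {}"
        using ab Z[of a] Z[of b] by (cases "a < m"; cases "b < m") (simp_all add: Y_def Int_commute)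
    qed
    have col: "\<chi> ((A i \<union> p i) \<union> (\<Union>l\<in>I. Y l)) = \<chi> (A i \<union> p i)" if I: "I \<subseteq> {..<Suc m}" for I
    proof (cases "m \<in> I")
      case False
      then have I': "I \<subseteq> {..<m}" using I by (auto simp: less_Suc_eq)
      then have "(A i \<union> p i) \<union> (\<Union>l\<in>I. Y l) = (A i \<union> (\<Union>l\<in>I. Z i l)) \<union> p i"
        unfolding Y_def by auto
      then show ?thesis using gi I' unfolding good_def by auto
    next
      case True
      define J where "J = I - {m}"
      have J: "J \<subseteq> {..<m}" and IJ: "I = insert m J" using I True by (auto simp: J_def less_Suc_eq)
      \<comment> \<open>Adjoining the new direction turns the segment \<open>p i\<close> into
        \<open>p j\<close>, so such vertices lie on the \<open>j\<close>-th cube, whose colour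
        agrees by the choice of \<open>i\<close> and \<open>j\<close>.\<close>
      have "p i \<union> Y m = p j" using ij unfolding p_def Y_def by auto
      moreover have "(\<Union>l\<in>J. Y l) = (\<Union>l\<in>J. Z j l)" using J Zij unfolding Y_def by auto
      ultimately have "(A i \<union> p i) \<union> (\<Union>l\<in>I. Y l) = (A j \<union> (\<Union>l\<in>J. Z j l)) \<union> p j"
        unfolding IJ using Aij by auto
      then have "\<chi> ((A i \<union> p i) \<union> (\<Union>l\<in>I. Y l)) = \<chi> (A j \<union> p j)"
        using gj J unfolding good_def by auto
      then show ?thesis using chij Aij by simp
    qed
    have sub: "Y l \<noteq> {} \<and> Y l \<subseteq> {..<n+q} \<and> Y l \<inter> (A i \<union> p i) = {}" if "l < Suc m" for l
    proof (cases "l < m")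
      case True
      then have "Z i l \<noteq> {}" "Z i l \<subseteq> {..<n}" "Z i l \<inter> A i = {}" using gi unfolding good_def by auto
      then show ?thesis using True unfolding Y_def p_def by fastforce
    next
      case False
      have "A i \<subseteq> {..<n}" using gi unfolding good_def by auto
      then show ?thesis using False ij unfolding Y_def p_def by auto
    qed
    have "A i \<noteq> {}" "A i \<subseteq> {..<n}" using gi unfolding good_def by auto
    then have "A i \<union> p i \<noteq> {} \<and> A i \<union> p i \<subseteq> {..<n+q}" using ij unfolding p_def by fastforce
    then show "\<exists>A Z. A \<noteq> {} \<and> A \<subseteq> {..<n+q} \<and>
      (\<forall>i<Suc m. Z i \<noteq> {} \<and> Z i \<subseteq> {..<n+q} \<and> Z i \<inter> A = {}) \<and>
      disjoint_family_on Z {..<Suc m} \<and> (\<forall>I\<subseteq>{..<Suc m}. \<chi> (A \<union> (\<Union>i\<in>I. Z i)) = \<chi> A)"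
      using sub disj col by (intro exI[of _ "A i \<union> p i"] exI[of _ Y]) auto
  qed
qed

text \<open>The base \<open>A\<close> of a monochromatic Hilbert cube is the topmost block: every union containing it
  lies in the cube, and the lower blocks are found inductively among the directions \<open>Z\<close>.\<close>

lemma finite_unions_max:
  fixes r k :: nat
  shows "\<exists>n. \<forall>\<chi> :: nat set \<Rightarrow> nat. (\<forall>S. \<chi> S < r) \<longrightarrow>
    (\<exists>B c. (\<forall>i<k. B i \<noteq> {} \<and> B i \<subseteq> {..<n}) \<and> disjoint_family_on B {..<k} \<and>
      (\<forall>I\<subseteq>{..<k}. I \<noteq> {} \<longrightarrow> \<chi> (\<Union>i\<in>I. B i) = c (Max I)))"
proof (induction k)
  case 0
  show ?case by (simp add: disjoint_family_on_def)
next
  case (Suc k)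
  then obtain m where m: "\<And>\<chi> :: nat set \<Rightarrow> nat. \<forall>S. \<chi> S < r \<Longrightarrow>
    (\<exists>B c. (\<forall>i<k. B i \<noteq> {} \<and> B i \<subseteq> {..<m}) \<and> disjoint_family_on B {..<k} \<and>
      (\<forall>I\<subseteq>{..<k}. I \<noteq> {} \<longrightarrow> \<chi> (\<Union>i\<in>I. B i) = c (Max I)))" by blast
  obtain n where n: "\<forall>\<chi> :: nat set \<Rightarrow> nat. (\<forall>S. \<chi> S < r) \<longrightarrow>
    (\<exists>A Z. A \<noteq> {} \<and> A \<subseteq> {..<n} \<and> (\<forall>i<m. Z i \<noteq> {} \<and> Z i \<subseteq> {..<n} \<and> Z i \<inter> A = {}) \<and>
      disjoint_family_on Z {..<m} \<and> (\<forall>I\<subseteq>{..<m}. \<chi> (A \<union> (\<Union>i\<in>I. Z i)) = \<chi> A))"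
    using hilbert_cube_unions[of r m] ..
  show ?case
  proof (intro exI[of _ n] allI impI)
    fix \<chi> :: "nat set \<Rightarrow> nat" assume chi: "\<forall>S. \<chi> S < r"
    obtain A Z where A: "A \<noteq> {}" "A \<subseteq> {..<n}"
      and Z: "\<forall>i<m. Z i \<noteq> {} \<and> Z i \<subseteq> {..<n} \<and> Z i \<inter> A = {}"
      and dZ: "disjoint_family_on Z {..<m}"
      and col: "\<forall>I\<subseteq>{..<m}. \<chi> (A \<union> (\<Union>i\<in>I. Z i)) = \<chi> A"
      using n[THEN spec, THEN mp, OF chi] by (elim exE conjE)
    \<comment> \<open>The induction hypothesis is applied to the colouring of sets of directions by
      the colour of their union; its blocks \<open>B i\<close> are sets of indices into
      \<open>Z\<close>.\<close>
    have "\<forall>S. \<chi> (\<Union>i\<in>S. Z i) < r" using chi by blast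
    from m[OF this] obtain B c where "\<forall>i<k. B i \<noteq> {} \<and> B i \<subseteq> {..<m}"
      and dB: "disjoint_family_on B {..<k}"
      and cB: "\<forall>I\<subseteq>{..<k}. I \<noteq> {} \<longrightarrow> \<chi> (\<Union>j\<in>(\<Union>i\<in>I. B i). Z j) = c (Max I)"
      by (elim exE conjE)
    then have B: "B i \<noteq> {} \<and> B i \<subseteq> {..<m}" if "i < k" for i using that by simp
    define B' where "B' = (\<lambda>i. if i < k then \<Union>j\<in>B i. Z j else A)"
    define c' where "c' = (\<lambda>i. if i < k then c i else \<chi> A)"
    have sub: "B' i \<noteq> {} \<and> B' i \<subseteq> {..<n}" if "i < Suc k" for i
    proof (cases "i < k")
      case True
      then have "B i \<noteq> {}" "B i \<subseteq> {..<m}" using B by auto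
      moreover have "\<forall>j\<in>B i. Z j \<noteq> {} \<and> Z j \<subseteq> {..<n}" using calculation Z by blast
      ultimately show ?thesis unfolding B'_def using True by (simp add: UN_subset_iff)
    next
      case False
      then show ?thesis using A unfolding B'_def by simp
    qed
    have dj1: "B' i \<inter> A = {}" if "i < k" for i
    proof -
      have "\<forall>j\<in>B i. Z j \<inter> A = {}" using B[OF that] Z by blast
      then show ?thesis using that unfolding B'_def by auto
    qed
    have dj2: "B' i \<inter> B' j = {}" if "i < k" "j < k" "i \<noteq> j" for i j
    proof -
      have "B i \<inter> B j = {}" using dB that unfolding disjoint_family_on_def by auto
      then have "Z a \<inter> Z b = {}" if "a \<in> B i" "b \<in> B j" for a b
      proof -
        have "a \<noteq> b" using that \<open>B i \<inter> B j = {}\<close> by auto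
        moreover have "a \<in> {..<m}" "b \<in> {..<m}" using that B[OF \<open>i < k\<close>] B[OF \<open>j < k\<close>] by auto
        ultimately show ?thesis using dZ unfolding disjoint_family_on_def by simp
      qed
      then show ?thesis using that unfolding B'_def by auto
    qed
    have B'k: "B' k = A" by (simp add: B'_def)
    have disj: "disjoint_family_on B' {..<Suc k}"
      unfolding disjoint_family_on_def
    proof (intro ballI impI)
      fix a b assume ab: "a \<in> {..<Suc k}" "b \<in> {..<Suc k}" "a \<noteq> b"
      show "B' a \<inter> B' b = {}"
        using ab dj1[of a] dj1[of b] dj2[of a b] B'k
        by (cases "a < k"; cases "b < k") (simp_all add: less_Suc_eq Int_commute)
    qed
    have colB: "\<chi> (\<Union>i\<in>I. B' i) = c' (Max I)" if I: "I \<subseteq> {..<Suc k}" "I \<noteq> {}" for I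
    proof -
      have finI: "finite I" using I(1) finite_subset by blast
      define J where "J = I - {k}"
      have J: "J \<subseteq> {..<k}" using I by (auto simp: J_def less_Suc_eq)
      have UJ: "(\<Union>i\<in>J. B' i) = (\<Union>j\<in>(\<Union>i\<in>J. B i). Z j)" using J unfolding B'_def by auto
      show ?thesis
      proof (cases "k \<in> I")
        case True
        have "Max I = k" using True I(1) finI by (intro Max_eqI) (auto simp: less_Suc_eq_le)
        moreover have "(\<Union>i\<in>I. B' i) = A \<union> (\<Union>j\<in>(\<Union>i\<in>J. B i). Z j)"
          using True UJ B'k unfolding J_def by auto
        moreover have "(\<Union>i\<in>J. B i) \<subseteq> {..<m}" using J B by fast
        then have "\<chi> (A \<union> (\<Union>j\<in>(\<Union>i\<in>J. B i). Z j)) = \<chi> A"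
          by (rule col[rule_format])
        ultimately show ?thesis unfolding c'_def by simp
      next
        case False
        then have "I = J" unfolding J_def by simp
        moreover have "Max I \<in> J" using Max_in[OF finI I(2)] calculation by simp
        then have "Max I < k" using J by auto
        ultimately show ?thesis using cB[rule_format, OF J] I(2) UJ unfolding c'_def by simp
      qed
    qed
    show "\<exists>B c. (\<forall>i<Suc k. B i \<noteq> {} \<and> B i \<subseteq> {..<n}) \<and> disjoint_family_on B {..<Suc k} \<and>
      (\<forall>I\<subseteq>{..<Suc k}. I \<noteq> {} \<longrightarrow> \<chi> (\<Union>i\<in>I. B i) = c (Max I))"
      using sub disj colB by (intro exI[of _ B'] exI[of _ c']) auto
  qed
qed

text \<open>Among \<open>r * k + 1\<close> blocks from \<open>finite_unions_max\<close>, pigeonhole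
  finds \<open>k\<close> blocks with the same \<open>c i\<close>. The colour of a union of these
  depends only on its largest index, so it is constant.\<close>

lemma finite_unions:
  fixes r k :: nat
  shows "\<exists>n. \<forall>\<chi> :: nat set \<Rightarrow> nat. (\<forall>S. \<chi> S < r) \<longrightarrow>
    (\<exists>B v. (\<forall>i<k. B i \<noteq> {} \<and> B i \<subseteq> {..<n}) \<and> disjoint_family_on B {..<k} \<and>
      (\<forall>I\<subseteq>{..<k}. I \<noteq> {} \<longrightarrow> \<chi> (\<Union>i\<in>I. B i) = v))"
proof -
  define K where "K = Suc (r * k)"
  obtain n where n: "\<And>\<chi> :: nat set \<Rightarrow> nat. (\<forall>S. \<chi> S < r) \<Longrightarrow>
    (\<exists>B c. (\<forall>i<K. B i \<noteq> {} \<and> B i \<subseteq> {..<n}) \<and> disjoint_family_on B {..<K} \<and>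
      (\<forall>I\<subseteq>{..<K}. I \<noteq> {} \<longrightarrow> \<chi> (\<Union>i\<in>I. B i) = c (Max I)))"
    using finite_unions_max[of r K] by blast
  show ?thesis
  proof (intro exI[of _ n] allI impI)
    fix \<chi> :: "nat set \<Rightarrow> nat" assume chi: "\<forall>S. \<chi> S < r"
    obtain B c where B: "\<And>i. i < K \<Longrightarrow> B i \<noteq> {} \<and> B i \<subseteq> {..<n}"
      and dB: "disjoint_family_on B {..<K}"
      and cB: "\<And>I. I \<subseteq> {..<K} \<Longrightarrow> I \<noteq> {} \<Longrightarrow> \<chi> (\<Union>i\<in>I. B i) = c (Max I)"
      using n[OF chi] by blast
    have c: "c i < r" if "i < K" for i
    proof -
      have "\<chi> (\<Union>j\<in>{i}. B j) = c (Max {i})" by (rule cB) (use that in auto)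
      then show ?thesis using chi by (metis Max_singleton)
    qed
    obtain v where v: "k \<le> card {i\<in>{..<K}. c i = v}"
    proof (rule ccontr)
      assume "\<not> thesis"
      then have *: "card {i\<in>{..<K}. c i = v} \<le> k" for v using that by (meson nat_le_linear)
      have "K = card (\<Union>v<r. {i\<in>{..<K}. c i = v})"
      proof -
        have "(\<Union>v<r. {i\<in>{..<K}. c i = v}) = {..<K}" using c by auto
        then show ?thesis by simp
      qed
      also have "\<dots> \<le> (\<Sum>v<r. card {i\<in>{..<K}. c i = v})" by (rule card_UN_le) simp
      also have "\<dots> \<le> r * k" using sum_bounded_above[of "{..<r}" "\<lambda>v. card {i\<in>{..<K}. c i = v}" k] * by simp
      finally show False unfolding K_def by simp
    qed
    then obtain V where V: "V \<subseteq> {i\<in>{..<K}. c i = v}" "card V = k" "finite V"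
      by (meson obtain_subset_with_card_n)
    then obtain e where e: "bij_betw e {..<k} V"
      using ex_bij_betw_nat_finite[OF V(3)] by (auto simp: atLeast0LessThan)
    have eV: "e i \<in> V" if "i < k" for i using e that by (auto simp: bij_betw_def)
    have eK: "e i < K" if "i < k" for i using V(1) eV[OF that] by auto
    have "\<chi> (\<Union>i\<in>I. B (e i)) = v" if I: "I \<subseteq> {..<k}" "I \<noteq> {}" for I
    proof -
      have "\<chi> (\<Union>i\<in>e ` I. B i) = c (Max (e ` I))" using I eK by (intro cB) auto
      moreover have "Max (e ` I) \<in> e ` I" using I finite_subset by (intro Max_in) auto
      moreover have "e ` I \<subseteq> V" using I eV by auto
      ultimately show ?thesis using V(1) by auto
    qed
    moreover have "disjoint_family_on (\<lambda>i. B (e i)) {..<k}"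
      unfolding disjoint_family_on_def
    proof (intro ballI impI)
      fix a b assume ab: "a \<in> {..<k}" "b \<in> {..<k}" "a \<noteq> b"
      then have "e a \<noteq> e b" using e by (auto simp: bij_betw_def inj_on_def)
      then show "B (e a) \<inter> B (e b) = {}" using dB ab eK unfolding disjoint_family_on_def by auto
    qed
    ultimately show "\<exists>B v. (\<forall>i<k. B i \<noteq> {} \<and> B i \<subseteq> {..<n}) \<and> disjoint_family_on B {..<k} \<and>
      (\<forall>I\<subseteq>{..<k}. I \<noteq> {} \<longrightarrow> \<chi> (\<Union>i\<in>I. B i) = v)"
      using B eK by (intro exI[of _ "\<lambda>i. B (e i)"] exI[of _ v]) auto
  qed
qed

section \<open>Polynomials on the discrete cube\<close>

text \<open>Up to the sign \<open>(- 1) ^ card S\<close>, this is the mixed difference of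
  \<open>F\<close> in the directions \<open>S\<close> at the empty vertex.\<close>

definition altsum :: "(nat set \<Rightarrow> real) \<Rightarrow> nat set \<Rightarrow> real" where
  "altsum F S = (\<Sum>T\<in>Pow S. (- 1) ^ card T * F T)"

lemma sum_Pow_insert:
  fixes F :: "'a set \<Rightarrow> 'b::comm_monoid_add"
  assumes "finite S" "a \<notin> S"
  shows "(\<Sum>T\<in>Pow (insert a S). F T) = (\<Sum>T\<in>Pow S. F T) + (\<Sum>T\<in>Pow S. F (insert a T))"
proof -
  have "inj_on (insert a) (Pow S)" using assms(2) by (auto simp: inj_on_def)
  moreover have "Pow S \<inter> insert a ` Pow S = {}" using assms(2) by auto
  ultimately show ?thesis using assms(1)
    by (simp add: Pow_insert sum.union_disjoint sum.reindex)
qed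

lemma altsum_insert:
  assumes "finite S" "a \<notin> S"
  shows "altsum F (insert a S) = altsum F S - altsum (\<lambda>T. F (insert a T)) S"
proof -
  have "(\<Sum>T\<in>Pow S. (- 1) ^ card (insert a T) * F (insert a T)) = - altsum (\<lambda>T. F (insert a T)) S"
    unfolding altsum_def sum_negf[symmetric]
  proof (rule sum.cong[OF refl])
    fix T assume "T \<in> Pow S"
    then have "finite T" "a \<notin> T" using assms finite_subset by auto
    then show "(- 1) ^ card (insert a T) * F (insert a T) = - ((- 1) ^ card T * F (insert a T))" by simp
  qed
  then show ?thesis by (simp add: altsum_def sum_Pow_insert[OF assms])
qed

text \<open>Moebius inversion over subsets: \<open>c\<close> holds the coefficients of
  \<open>F\<close> as a multilinear polynomial in 0-1 coordinates, and the alternating sum isolates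
  the top one.\<close>

lemma altsum_of_coeffs:
  assumes "finite S" "\<And>T. T \<subseteq> S \<Longrightarrow> F T = (\<Sum>A\<in>Pow T. c A)"
  shows "altsum F S = (- 1) ^ card S * c S"
  using assms
proof (induction S arbitrary: F c rule: finite_induct)
  case empty
  then show ?case by (simp add: altsum_def)
next
  case (insert a S)
  have 1: "altsum F S = (- 1) ^ card S * c S" using insert.prems by (intro insert.IH) auto
  have "altsum (\<lambda>T. F (insert a T)) S = (- 1) ^ card S * (c S + c (insert a S))"
  proof (rule insert.IH)
    fix T assume T: "T \<subseteq> S"
    then have "finite T" "a \<notin> T" using insert.hyps finite_subset by auto
    moreover have "F (insert a T) = (\<Sum>A\<in>Pow (insert a T). c A)" using T by (intro insert.prems) auto
    ultimately show "F (insert a T) = (\<Sum>A\<in>Pow T. c A + c (insert a A))"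
      by (simp add: sum_Pow_insert sum.distrib)
  qed
  then show ?case using insert.hyps 1 by (simp add: altsum_insert algebra_simps)
qed

text \<open>Every function on the cube is multilinear: a coefficient whose index contains
  \<open>a\<close> is the difference of the coefficients on the two faces with and without
  \<open>a\<close>.\<close>

lemma coeffs_exist:
  assumes "finite K"
  shows "\<exists>c :: nat set \<Rightarrow> real. \<forall>T\<subseteq>K. F T = (\<Sum>A\<in>Pow T. c A)"
  using assms
proof (induction K arbitrary: F rule: finite_induct)
  case empty
  show ?case by (intro exI[of _ "\<lambda>_. F {}"]) simp
next
  case (insert a K)
  obtain c where c: "\<forall>T\<subseteq>K. F T = (\<Sum>A\<in>Pow T. c A)" using insert.IH by blast
  obtain d where d: "\<forall>T\<subseteq>K. F (insert a T) = (\<Sum>A\<in>Pow T. d A)"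
    using insert.IH[of "\<lambda>T. F (insert a T)"] by blast
  define c' where "c' = (\<lambda>A. if a \<in> A then d (A - {a}) - c (A - {a}) else c A)"
  have c'1: "(\<Sum>A\<in>Pow T. c' A) = F T" if T: "T \<subseteq> K" for T
  proof -
    have "(\<Sum>A\<in>Pow T. c' A) = (\<Sum>A\<in>Pow T. c A)"
      using T insert.hyps(2) by (intro sum.cong) (auto simp: c'_def)
    then show ?thesis using c T by simp
  qed
  have "F T = (\<Sum>A\<in>Pow T. c' A)" if T: "T \<subseteq> insert a K" for T
  proof (cases "a \<in> T")
    case False
    then show ?thesis using T c'1[of T] by (simp add: subset_insert)
  next
    case True
    define R where "R = T - {a}"
    have R: "R \<subseteq> K" "a \<notin> R" "T = insert a R" using True T by (auto simp: R_def)
    then have "finite R" using insert.hyps finite_subset by auto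
    have "(\<Sum>A\<in>Pow R. c' (insert a A)) = (\<Sum>A\<in>Pow R. d A - c A)"
    proof (rule sum.cong[OF refl])
      fix A assume "A \<in> Pow R"
      then have "A - {a} = A" using R(2) by auto
      then show "c' (insert a A) = d A - c A" by (simp add: c'_def)
    qed
    then have "(\<Sum>A\<in>Pow T. c' A) = F R + ((\<Sum>A\<in>Pow R. d A) - (\<Sum>A\<in>Pow R. c A))"
      using R \<open>finite R\<close> c'1 by (simp add: sum_Pow_insert sum_subtractf)
    then show ?thesis using c d R by simp
  qed
  then show ?case by blast
qed

text \<open>Testing only faces through the empty vertex suffices, because their alternating sums
  are, up to sign, the multilinear coefficients.\<close>

definition cube_degree_le :: "nat set \<Rightarrow> nat \<Rightarrow> (nat set \<Rightarrow> real) \<Rightarrow> bool" where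
  "cube_degree_le K d F \<longleftrightarrow> (\<forall>S\<subseteq>K. card S > d \<longrightarrow> altsum F S = 0)"

lemma cube_degree_le_mono: "cube_degree_le K d F \<Longrightarrow> d \<le> d' \<Longrightarrow> cube_degree_le K d' F"
  unfolding cube_degree_le_def by auto

lemma altsum_add: "altsum (\<lambda>T. F T + G T) S = altsum F S + altsum G S"
  by (simp add: altsum_def sum.distrib algebra_simps)

lemma altsum_diff: "altsum (\<lambda>T. F T - G T) S = altsum F S - altsum G S"
  by (simp add: altsum_def sum_subtractf algebra_simps)

lemma altsum_minus: "altsum (\<lambda>T. - F T) S = - altsum F S"
  by (simp add: altsum_def sum_negf)

lemma cube_degree_le_add:
  "cube_degree_le K d F \<Longrightarrow> cube_degree_le K d G \<Longrightarrow> cube_degree_le K d (\<lambda>T. F T + G T)"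
  unfolding cube_degree_le_def by (simp add: altsum_add)

lemma cube_degree_le_minus: "cube_degree_le K d F \<Longrightarrow> cube_degree_le K d (\<lambda>T. - F T)"
  unfolding cube_degree_le_def by (simp add: altsum_minus)

lemma altsum_const: "finite S \<Longrightarrow> altsum (\<lambda>_. v) S = (if S = {} then v else 0)"
  using altsum_of_coeffs[of S "\<lambda>_. v" "\<lambda>A. if A = {} then v else 0"]
  by (auto simp: finite_subset)

lemma cube_degree_le_const: "finite K \<Longrightarrow> cube_degree_le K d (\<lambda>_. v)"
  unfolding cube_degree_le_def by (auto simp: altsum_const finite_subset)

lemma cube_degree_le_coeffs:
  assumes "finite K" "cube_degree_le K d F"
  obtains c where "\<And>T. T \<subseteq> K \<Longrightarrow> F T = (\<Sum>A\<in>Pow T. c A)"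
    "\<And>A. A \<subseteq> K \<Longrightarrow> card A > d \<Longrightarrow> c A = 0"
proof -
  obtain c where c: "\<forall>T\<subseteq>K. F T = (\<Sum>A\<in>Pow T. c A)" using coeffs_exist[OF assms(1)] by blast
  have "c A = 0" if A: "A \<subseteq> K" "card A > d" for A
  proof -
    have "altsum F A = (- 1) ^ card A * c A"
      using A c assms(1) finite_subset by (intro altsum_of_coeffs) auto
    then show ?thesis using assms(2) A unfolding cube_degree_le_def by simp
  qed
  then show thesis using that c by blast
qed

text \<open>As coordinates are 0 or 1, the monomials indexed by \<open>A\<close> and
  \<open>B\<close> multiply to the one indexed by \<open>A \<union> B\<close>. If this union has
  more than \<open>d + e\<close> elements, one of the two coefficients vanishes.\<close>

lemma cube_degree_le_mult:
  assumes K: "finite K" and F: "cube_degree_le K d F" and G: "cube_degree_le K e G"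
  shows "cube_degree_le K (d + e) (\<lambda>T. F T * G T)"
  unfolding cube_degree_le_def
proof (intro allI impI)
  fix S assume S: "S \<subseteq> K" "card S > d + e"
  obtain a where a: "\<And>T. T \<subseteq> K \<Longrightarrow> F T = (\<Sum>A\<in>Pow T. a A)" "\<And>A. A \<subseteq> K \<Longrightarrow> card A > d \<Longrightarrow> a A = 0"
    using cube_degree_le_coeffs[OF K F] by blast
  obtain b where b: "\<And>T. T \<subseteq> K \<Longrightarrow> G T = (\<Sum>A\<in>Pow T. b A)" "\<And>A. A \<subseteq> K \<Longrightarrow> card A > e \<Longrightarrow> b A = 0"
    using cube_degree_le_coeffs[OF K G] by blast
  define c where "c = (\<lambda>C. \<Sum>p\<in>{p. fst p \<union> snd p = C}. a (fst p) * b (snd p))"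
  have "altsum (\<lambda>T. F T * G T) S = (- 1) ^ card S * c S"
  proof (rule altsum_of_coeffs)
    show "finite S" using S K finite_subset by auto
    fix T assume T: "T \<subseteq> S"
    then have fT: "finite T" using \<open>finite S\<close> finite_subset by auto
    have TK: "T \<subseteq> K" using T S by auto
    have "F T * G T = (\<Sum>p\<in>Pow T \<times> Pow T. a (fst p) * b (snd p))"
      using a(1)[OF TK] b(1)[OF TK] by (simp add: sum_product sum.cartesian_product case_prod_unfold)
    also have "\<dots> = (\<Sum>C\<in>Pow T. \<Sum>p\<in>{p\<in>Pow T \<times> Pow T. fst p \<union> snd p = C}. a (fst p) * b (snd p))"
      using fT by (intro sum.group[symmetric]) auto
    also have "\<dots> = (\<Sum>C\<in>Pow T. c C)"
      unfolding c_def by (intro sum.cong) auto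
    finally show "F T * G T = (\<Sum>C\<in>Pow T. c C)" .
  qed
  moreover have "c S = 0"
    unfolding c_def
  proof (rule sum.neutral, rule ballI)
    fix p assume "p \<in> {p. fst p \<union> snd p = S}"
    then have p: "fst p \<union> snd p = S" by simp
    then have "card S \<le> card (fst p) + card (snd p)" using card_Un_le by metis
    then have "card (fst p) > d \<or> card (snd p) > e" using S(2) by auto
    then show "a (fst p) * b (snd p) = 0" using a(2)[of "fst p"] b(2)[of "snd p"] p S(1) by auto
  qed
  ultimately show "altsum (\<lambda>T. F T * G T) S = 0" by simp
qed

lemma cube_degree_le_linear:
  assumes "finite K" "\<And>T. T \<subseteq> K \<Longrightarrow> F T = x + (\<Sum>i\<in>T. h i)"
  shows "cube_degree_le K 1 F"
  unfolding cube_degree_le_def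
proof (intro allI impI)
  fix S assume S: "S \<subseteq> K" "1 < card S"
  then have fS: "finite S" using assms(1) finite_subset by auto
  define c where "c = (\<lambda>A. if A = {} then x else if card A = 1 then h (the_elem A) else 0)"
  have "F T = (\<Sum>A\<in>Pow T. c A)" if T: "T \<subseteq> S" for T
  proof -
    have fT: "finite T" using T fS finite_subset by auto
    have "(\<Sum>A\<in>Pow T. c A) = (\<Sum>A\<in>insert {} ((\<lambda>i. {i}) ` T). c A)"
      using fT by (intro sum.mono_neutral_right) (auto simp: c_def card_1_singleton_iff)
    also have "\<dots> = c {} + (\<Sum>A\<in>(\<lambda>i. {i}) ` T. c A)" using fT by (subst sum.insert) auto
    also have "(\<Sum>A\<in>(\<lambda>i. {i}) ` T. c A) = (\<Sum>i\<in>T. h i)"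
      by (subst sum.reindex) (auto simp: c_def)
    finally show ?thesis using assms(2)[of T] T S by (simp add: c_def)
  qed
  from altsum_of_coeffs[OF fS this] have "altsum F S = (- 1) ^ card S * c S" by blast
  then show "altsum F S = 0" using S by (auto simp: c_def)
qed

lemma cube_degree_le_power:
  assumes "finite K" "cube_degree_le K 1 F"
  shows "cube_degree_le K j (\<lambda>T. F T ^ j)"
proof (induction j)
  case 0
  show ?case using cube_degree_le_const[OF assms(1)] by simp
next
  case (Suc j)
  show ?case using cube_degree_le_mult[OF assms(1) assms(2) Suc] by simp
qed

section \<open>Bracket forms on the discrete cube\<close>

lemma sfrac_bound: "\<bar>sfrac x\<bar> \<le> 1 / 2"
  using sfrac_char[of "sfrac x" x] by auto

lemma sfrac_diff_Ints: "sfrac x - x \<in> \<int>"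
  by (simp add: sfrac_def)

lemma altsum_Ints:
  assumes "\<And>T. T \<subseteq> S \<Longrightarrow> F T \<in> \<int>"
  shows "altsum F S \<in> \<int>"
  unfolding altsum_def using assms by (intro Ints_sum Ints_mult Ints_power) auto

text \<open>The alternating sums of the fractional parts differ from those of the original function by
  integers, so they vanish as soon as they are smaller than 1 in absolute value.\<close>

lemma cube_degree_le_sfrac:
  assumes "cube_degree_le K d F"
    and small: "\<And>S. S \<subseteq> K \<Longrightarrow> S \<noteq> {} \<Longrightarrow> \<bar>altsum (\<lambda>T. sfrac (F T)) S\<bar> < 1"
  shows "cube_degree_le K d (\<lambda>T. sfrac (F T))"
  unfolding cube_degree_le_def
proof (intro allI impI)
  fix S assume S: "S \<subseteq> K" "d < card S"
  have "altsum (\<lambda>T. sfrac (F T) - F T) S \<in> \<int>" by (intro altsum_Ints sfrac_diff_Ints)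
  moreover have "altsum F S = 0" using assms(1) S unfolding cube_degree_le_def by auto
  ultimately have "altsum (\<lambda>T. sfrac (F T)) S \<in> \<int>" by (simp add: altsum_diff)
  moreover have "S \<noteq> {}" using S by auto
  ultimately show "altsum (\<lambda>T. sfrac (F T)) S = 0"
    using small[OF S(1)] by (auto elim!: Ints_cases simp flip: of_int_abs)
qed

text \<open>The arguments of all brackets, nested ones included: the forms whose fractional parts
  have to be controlled.\<close>

primrec fracs :: "bracket_form \<Rightarrow> bracket_form set" where
  "fracs (Poly p) = {}"
| "fracs (Neg \<Phi>) = fracs \<Phi>"
| "fracs (Frac \<Phi>) = insert \<Phi> (fracs \<Phi>)"
| "fracs (Mult \<Phi> \<Psi>) = fracs \<Phi> \<union> fracs \<Psi>"
| "fracs (Add \<Phi> \<Psi>) = fracs \<Phi> \<union> fracs \<Psi>"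

lemma finite_fracs: "finite (fracs \<Phi>)"
  by (induction \<Phi>) auto

lemma constant_free_fracs: "constant_free \<Phi> \<Longrightarrow> \<Psi> \<in> fracs \<Phi> \<Longrightarrow> constant_free \<Psi>"
  by (induction \<Phi>) auto

lemma fracs_trans: "\<Psi> \<in> fracs \<Phi> \<Longrightarrow> fracs \<Psi> \<subseteq> fracs \<Phi>"
  by (induction \<Phi>) auto

lemma degree_at_most_fracs:
  "degree_at_most \<Phi> d \<Longrightarrow> \<Psi> \<in> fracs \<Phi> \<Longrightarrow> \<exists>e\<le>d. degree_at_most \<Psi> e"
proof (induction rule: degree_at_most.induct)
  case (4 \<Phi>1 k1 \<Phi>2 k2)
  then show ?case by simp (meson trans_le_add1 trans_le_add2)
next
  case (5 \<Phi>1 k1 \<Phi>2 k2)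
  then show ?case by simp (meson max.coboundedI1 max.coboundedI2)
qed auto

lemma realise_zero: "constant_free \<Phi> \<Longrightarrow> realise \<alpha> \<Phi> 0 = 0"
proof (induction \<Phi>)
  case (Poly p)
  have "realise_monomial \<alpha> m 0 = 0" if "m \<in> set p" for m
    using Poly that by (cases m) auto
  then show ?case by (simp cong: map_cong)
qed (auto simp: sfrac_def ceiling_eq_iff)

text \<open>The vertices \<open>n T\<close> are affine in the cube coordinates, so
  \<open>n ^ j\<close> has degree at most \<open>j\<close>. Sums and products follow the degree
  rules, and brackets keep the degree by \<open>cube_degree_le_sfrac\<close>.\<close>

lemma cube_degree_le_realise:
  fixes n :: "nat set \<Rightarrow> nat"
  assumes K: "finite K" and n: "\<And>T. T \<subseteq> K \<Longrightarrow> real (n T) = x + (\<Sum>i\<in>T. h i)"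
    and "degree_at_most \<Phi> d"
    and "\<And>\<Psi> S. \<Psi> \<in> fracs \<Phi> \<Longrightarrow> S \<subseteq> K \<Longrightarrow> S \<noteq> {} \<Longrightarrow>
      \<bar>altsum (\<lambda>T. sfrac (realise \<alpha> \<Psi> (n T))) S\<bar> < 1"
  shows "cube_degree_le K d (\<lambda>T. realise \<alpha> \<Phi> (n T))"
  using assms(3,4)
proof (induction rule: degree_at_most.induct)
  case (1 p k)
  have mon: "cube_degree_le K k (\<lambda>T. realise_monomial \<alpha> m (n T))" if "mono_degree m \<le> k" for m
  proof (cases m)
    case (Monomial s l j)
    have "cube_degree_le K j (\<lambda>T. real (n T) ^ j)"
      using K n by (intro cube_degree_le_power cube_degree_le_linear)
    then have "cube_degree_le K (0 + j) (\<lambda>T. ((if s then - 1 else 1) * prod_list (map \<alpha> l)) * real (n T) ^ j)"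
      using K by (intro cube_degree_le_mult cube_degree_le_const)
    then show ?thesis using that Monomial by (auto intro: cube_degree_le_mono)
  qed
  show ?case using 1(1)
  proof (induction p)
    case Nil
    show ?case using cube_degree_le_const[OF K] by simp
  next
    case (Cons m p)
    then have "cube_degree_le K k (\<lambda>T. realise_monomial \<alpha> m (n T) + realise \<alpha> (Poly p) (n T))"
      using mon by (intro cube_degree_le_add) auto
    then show ?case by simp
  qed
next
  case (2 \<Phi> k)
  then show ?case by (auto intro: cube_degree_le_minus)
next
  case (3 \<Phi> k)
  have "cube_degree_le K k (\<lambda>T. realise \<alpha> \<Phi> (n T))" using 3 by auto
  then have "cube_degree_le K k (\<lambda>T. sfrac (realise \<alpha> \<Phi> (n T)))"
    using 3(3) by (intro cube_degree_le_sfrac) auto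
  then show ?case by simp
next
  case (4 \<Phi>1 k1 \<Phi>2 k2)
  then show ?case using K by (auto intro!: cube_degree_le_mult)
next
  case (5 \<Phi>1 k1 \<Phi>2 k2)
  then have "cube_degree_le K (max k1 k2) (\<lambda>T. realise \<alpha> \<Phi>1 (n T))"
    "cube_degree_le K (max k1 k2) (\<lambda>T. realise \<alpha> \<Phi>2 (n T))"
    by (auto intro: cube_degree_le_mono)
  then show ?case by (auto intro: cube_degree_le_add)
qed

section \<open>Recurrence for bracket polynomials\<close>

text \<open>Constants have alternating sum 0 over a nonempty face, so \<open>v\<close> may be
  subtracted. The vertex \<open>{}\<close> is kept apart since nothing is assumed about
  \<open>F\<close> there.\<close>

lemma altsum_close:
  assumes "finite S" "S \<noteq> {}" "0 \<le> \<epsilon>" and F: "\<And>T. T \<subseteq> S \<Longrightarrow> T \<noteq> {} \<Longrightarrow> \<bar>F T - v\<bar> \<le> \<epsilon>"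
  shows "\<bar>altsum F S - (F {} - v)\<bar> \<le> 2 ^ card S * \<epsilon>"
proof -
  have "altsum F S = altsum (\<lambda>T. F T - v) S"
    using assms(1,2) by (simp add: altsum_diff altsum_const)
  also have "\<dots> = (F {} - v) + (\<Sum>T\<in>Pow S - {{}}. (- 1) ^ card T * (F T - v))"
    unfolding altsum_def using assms(1) by (subst sum.remove[of _ "{}"]) auto
  finally have "\<bar>altsum F S - (F {} - v)\<bar> = \<bar>\<Sum>T\<in>Pow S - {{}}. (- 1) ^ card T * (F T - v)\<bar>" by simp
  also have "\<dots> \<le> (\<Sum>T\<in>Pow S - {{}}. \<bar>(- 1) ^ card T * (F T - v)\<bar>)" by (rule sum_abs)
  also have "\<dots> \<le> of_nat (card (Pow S - {{}})) * \<epsilon>"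
    using F by (intro sum_bounded_above) (auto simp: abs_mult power_abs)
  also have "\<dots> \<le> 2 ^ card S * \<epsilon>"
  proof (rule mult_right_mono[OF _ assms(3)])
    have "card (Pow S - {{}}) \<le> card (Pow S)" using assms(1) by (intro card_mono) auto
    also have "\<dots> = 2 ^ card S" using assms(1) by (rule card_Pow)
    finally show "real (card (Pow S - {{}})) \<le> 2 ^ card S" by (metis of_nat_le_iff of_nat_numeral of_nat_power)
  qed
  finally show ?thesis .
qed

text \<open>A bracket at the empty vertex is uncontrolled but contributes at most 1/2; the other
  vertices contribute at most \<open>2 ^ Suc d / 2 ^ (d + 3)\<close>, which is 1/4. The total stays
  below 1.\<close>

lemma altsum_realise_eq_0:
  fixes n :: "nat set \<Rightarrow> nat"
  assumes K: "finite K" "card K = Suc d" and n: "\<And>T. T \<subseteq> K \<Longrightarrow> real (n T) = x + (\<Sum>i\<in>T. h i)"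
    and deg: "degree_at_most \<Phi> d"
    and small: "\<And>\<Psi> T. \<Psi> \<in> fracs \<Phi> \<Longrightarrow> T \<subseteq> K \<Longrightarrow> T \<noteq> {} \<Longrightarrow>
      \<bar>sfrac (realise \<alpha> \<Psi> (n T))\<bar> \<le> 1 / 2 ^ (d + 3)"
  shows "altsum (\<lambda>T. realise \<alpha> \<Phi> (n T)) K = 0"
proof -
  have "\<bar>altsum (\<lambda>T. sfrac (realise \<alpha> \<Psi> (n T))) S\<bar> < 1"
    if S: "\<Psi> \<in> fracs \<Phi>" "S \<subseteq> K" "S \<noteq> {}" for \<Psi> S
  proof -
    define G where "G = (\<lambda>T. sfrac (realise \<alpha> \<Psi> (n T)))"
    have fS: "finite S" using S K finite_subset by auto
    have "\<bar>altsum G S - (G {} - 0)\<bar> \<le> 2 ^ card S * (1 / 2 ^ (d + 3))"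
      using fS S small unfolding G_def by (intro altsum_close) auto
    moreover have "(2::real) ^ card S * (1 / 2 ^ (d + 3)) \<le> 2 ^ Suc d * (1 / 2 ^ (d + 3))"
      using card_mono[OF K(1) S(2)] K(2) by (intro mult_right_mono power_increasing) auto
    moreover have "(2::real) ^ Suc d * (1 / 2 ^ (d + 3)) = 1 / 4"
      by (simp add: power_add)
    moreover have "\<bar>G {}\<bar> \<le> 1 / 2" unfolding G_def by (rule sfrac_bound)
    ultimately show ?thesis unfolding G_def[symmetric] by linarith
  qed
  then have "cube_degree_le K d (\<lambda>T. realise \<alpha> \<Phi> (n T))"
    using K n deg by (intro cube_degree_le_realise) auto
  then show ?thesis using K(2) unfolding cube_degree_le_def by auto
qed

text \<open>Colour \<open>S\<close> by the rough values of all bracketed quantities at \<open>card S * m\<close>. On a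
  monochromatic cube of unions these quantities are polynomials of degree at most \<open>d\<close> that vanish
  at the empty vertex and are almost constant elsewhere, so the constant must be close to zero.\<close>

lemma bracket_recurrence:
  assumes cf: "constant_free \<Phi>" and deg: "degree_at_most \<Phi> d"
  shows "\<exists>n0>0. \<forall>\<alpha> m. \<exists>j\<in>{1..n0}. \<forall>\<Psi>\<in>fracs \<Phi>. \<bar>sfrac (realise \<alpha> \<Psi> (j * m))\<bar> \<le> 1 / 2 ^ (d + 3)"
proof -
  define k where "k = Suc d"
  \<comment> \<open>Chosen so that \<open>2 ^ k * \<epsilon>\<close> is
    \<open>1 / 2 ^ (d + 4)\<close>: below the bound to be proved, and still less than 1 when 1/2 is
    added.\<close>
  define \<epsilon> :: real where "\<epsilon> = 1 / 2 ^ (2 * d + 5)"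
  have eps: "\<epsilon> > 0" by (simp add: \<epsilon>_def)
  \<comment> \<open>\<open>L\<close> is \<open>1 / \<epsilon>\<close>, so rounding a fractional part
    to multiples of \<open>\<epsilon>\<close> leaves finitely many colours, which \<open>e\<close>
    numbers.\<close>
  define L :: int where "L = 2 ^ (2 * d + 5)"
  define X where "X = fracs \<Phi> \<rightarrow>\<^sub>E {- L..L}"
  have "finite X" unfolding X_def by (intro finite_PiE finite_fracs) simp
  then obtain e where e: "bij_betw e X {0..<card X}" using ex_bij_betw_finite_nat by blast
  obtain n where n: "\<forall>\<chi> :: nat set \<Rightarrow> nat. (\<forall>S. \<chi> S < card X) \<longrightarrow>
    (\<exists>B v. (\<forall>i<k. B i \<noteq> {} \<and> B i \<subseteq> {..<n}) \<and> disjoint_family_on B {..<k} \<and>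
      (\<forall>I\<subseteq>{..<k}. I \<noteq> {} \<longrightarrow> \<chi> (\<Union>i\<in>I. B i) = v))"
    using finite_unions[of "card X" k] ..
  have "\<exists>j\<in>{1..Suc n}. \<forall>\<Psi>\<in>fracs \<Phi>. \<bar>sfrac (realise \<alpha> \<Psi> (j * m))\<bar> \<le> 1 / 2 ^ (d + 3)" for \<alpha> m
  proof -
    define rough where "rough = (\<lambda>S :: nat set. restrict (\<lambda>\<Psi>. \<lfloor>sfrac (realise \<alpha> \<Psi> (card S * m)) / \<epsilon>\<rfloor>) (fracs \<Phi>))"
    have rX: "rough S \<in> X" for S
    proof -
      have "\<lfloor>sfrac y / \<epsilon>\<rfloor> \<in> {- L..L}" for y
      proof -
        have "\<bar>sfrac y / \<epsilon>\<bar> \<le> of_int L"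
          using sfrac_bound[of y] by (simp add: \<epsilon>_def L_def abs_mult)
        then have "- of_int L \<le> sfrac y / \<epsilon>" "sfrac y / \<epsilon> \<le> of_int L" by linarith+
        then show ?thesis by (simp add: le_floor_iff floor_le_iff)
      qed
      then show ?thesis unfolding rough_def X_def by (intro restrict_PiE_iff[THEN iffD2]) blast
    qed
    have "\<forall>S. e (rough S) < card X" using e rX by (auto simp: bij_betw_def)
    from n[THEN spec[where x = "\<lambda>S. e (rough S)"], THEN mp, OF this]
    obtain B v where B: "\<forall>i<k. B i \<noteq> {} \<and> B i \<subseteq> {..<n}" and dB: "disjoint_family_on B {..<k}"
      and v: "\<forall>I\<subseteq>{..<k}. I \<noteq> {} \<longrightarrow> e (rough (\<Union>i\<in>I. B i)) = v"
      by (elim exE conjE)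
    define p where "p = (\<lambda>T. card (\<Union>i\<in>T. B i) * m)"
    have finB: "finite (B i)" if "i < k" for i
    proof -
      have "B i \<subseteq> {..<n}" using B that by auto
      then show ?thesis using finite_subset by blast
    qed
    have preal: "real (p T) = 0 + (\<Sum>i\<in>T. real (card (B i) * m))" if T: "T \<subseteq> {..<k}" for T
    proof -
      have fT: "finite T" using T finite_subset by blast
      have "card (\<Union>i\<in>T. B i) = (\<Sum>i\<in>T. card (B i))"
      proof (rule card_UN_disjoint[OF fT])
        show "\<forall>i\<in>T. finite (B i)" using T finB by auto
        show "\<forall>i\<in>T. \<forall>j\<in>T. i \<noteq> j \<longrightarrow> B i \<inter> B j = {}"
          using T dB unfolding disjoint_family_on_def by (meson in_mono)
      qed
      then show ?thesis by (simp add: p_def sum_distrib_right)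
    qed
    have zeroB: "{0} \<subseteq> {..<k}" by (auto simp: k_def)
    have close: "\<bar>sfrac (realise \<alpha> \<Psi> (p T)) - sfrac (realise \<alpha> \<Psi> (p {0}))\<bar> \<le> \<epsilon>"
      if \<Psi>: "\<Psi> \<in> fracs \<Phi>" and T: "T \<subseteq> {..<k}" "T \<noteq> {}" for \<Psi> T
    proof -
      have "e (rough (\<Union>i\<in>T. B i)) = e (rough (\<Union>i\<in>{0}. B i))"
        using v[rule_format, OF T] v[rule_format, OF zeroB] by (metis insert_not_empty)
      then have "rough (\<Union>i\<in>T. B i) = rough (\<Union>i\<in>{0}. B i)"
        using e rX unfolding bij_betw_def by (meson inj_onD)
      then have "rough (\<Union>i\<in>T. B i) \<Psi> = rough (\<Union>i\<in>{0}. B i) \<Psi>" by simp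
      then have "\<lfloor>sfrac (realise \<alpha> \<Psi> (p T)) / \<epsilon>\<rfloor> = \<lfloor>sfrac (realise \<alpha> \<Psi> (p {0})) / \<epsilon>\<rfloor>"
        using \<Psi> by (simp add: rough_def p_def)
      then have "\<bar>sfrac (realise \<alpha> \<Psi> (p T)) / \<epsilon> - sfrac (realise \<alpha> \<Psi> (p {0})) / \<epsilon>\<bar> \<le> 1"
        by linarith
      then show ?thesis using eps by (simp add: field_simps flip: diff_divide_distrib)
    qed
    have p0: "p {} = 0" by (simp add: p_def)
    have zero: "sfrac (realise \<alpha> \<Psi> (p {})) = 0" if "\<Psi> \<in> fracs \<Phi>" for \<Psi>
      using realise_zero[of "Frac \<Psi>" \<alpha>] constant_free_fracs[OF cf that] by (simp add: p0)
    have est: "\<bar>altsum (\<lambda>T. sfrac (realise \<alpha> \<Psi> (p T))) S - (0 - sfrac (realise \<alpha> \<Psi> (p {0})))\<bar> \<le> 2 ^ k * \<epsilon>"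
      if \<Psi>: "\<Psi> \<in> fracs \<Phi>" and S: "S \<subseteq> {..<k}" "S \<noteq> {}" for \<Psi> S
    proof -
      define G where "G = (\<lambda>T. sfrac (realise \<alpha> \<Psi> (p T)))"
      have "finite S" using S finite_subset by blast
      then have "\<bar>altsum G S - (G {} - G {0})\<bar> \<le> 2 ^ card S * \<epsilon>"
        using S eps close[OF \<Psi>] unfolding G_def by (intro altsum_close) auto
      also have "\<dots> \<le> 2 ^ k * \<epsilon>"
        using card_mono[OF _ S(1)] eps by (intro mult_right_mono power_increasing) auto
      finally show ?thesis using zero[OF \<Psi>] by (simp add: G_def)
    qed
    have small: "2 ^ k * \<epsilon> = 1 / 2 ^ (d + 4)"
      by (simp add: k_def \<epsilon>_def field_simps flip: power_add power_Suc)
    have le: "1 / 2 ^ (d + 4) \<le> (1 / 16 :: real)"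
      by (simp add: field_simps power_add)
    have lt1: "\<bar>altsum (\<lambda>T. sfrac (realise \<alpha> \<Psi> (p T))) S\<bar> < 1"
      if "\<Psi> \<in> fracs \<Phi>" "S \<subseteq> {..<k}" "S \<noteq> {}" for \<Psi> S
      using est[OF that] sfrac_bound[of "realise \<alpha> \<Psi> (p {0})"] small le by linarith
    have "\<bar>sfrac (realise \<alpha> \<Psi> (card (B 0) * m))\<bar> \<le> 1 / 2 ^ (d + 3)" if \<Psi>: "\<Psi> \<in> fracs \<Phi>" for \<Psi>
    proof -
      obtain c where c: "c \<le> d" "degree_at_most \<Psi> c" using degree_at_most_fracs[OF deg \<Psi>] by blast
      \<comment> \<open>The degree is below \<open>k\<close>, so the alternating sum over the whole
        cube vanishes. By \<open>est\<close> that sum is nearly minus the common value, which must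
        therefore be small.\<close>
      have "cube_degree_le {..<k} c (\<lambda>T. realise \<alpha> (Frac \<Psi>) (p T))"
      proof (rule cube_degree_le_realise[OF _ preal])
        show "degree_at_most (Frac \<Psi>) c" using c(2) by (rule degree_at_most.intros)
        fix \<Psi>' S assume S: "\<Psi>' \<in> fracs (Frac \<Psi>)" "S \<subseteq> {..<k}" "S \<noteq> {}"
        have "\<Psi>' \<in> fracs \<Phi>" using S(1) \<Psi> fracs_trans by auto
        then show "\<bar>altsum (\<lambda>T. sfrac (realise \<alpha> \<Psi>' (p T))) S\<bar> < 1" using lt1 S by blast
      qed auto
      then have "altsum (\<lambda>T. sfrac (realise \<alpha> \<Psi> (p T))) {..<k} = 0"
        using c(1) unfolding cube_degree_le_def k_def by simp
      moreover have "{..<k} \<noteq> {}" using zeroB by auto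
      ultimately have "\<bar>sfrac (realise \<alpha> \<Psi> (p {0}))\<bar> \<le> 2 ^ k * \<epsilon>" using est[OF \<Psi>, of "{..<k}"] by simp
      also have "\<dots> \<le> 1 / 2 ^ (d + 3)" unfolding small by (simp add: field_simps power_add)
      finally show ?thesis by (simp add: p_def)
    qed
    moreover have "card (B 0) \<in> {1..Suc n}"
    proof -
      have B0: "B 0 \<noteq> {}" "B 0 \<subseteq> {..<n}" using B by (auto simp: k_def)
      have "card (B 0) \<le> card {..<n}" using B0(2) by (intro card_mono) auto
      moreover have "card (B 0) > 0" using B0 finB[of 0] by (simp add: card_gt_0_iff k_def)
      ultimately show ?thesis by simp
    qed
    ultimately show ?thesis by blast
  qed
  then show ?thesis by (intro exI[of _ "Suc n"]) auto
qed

text \<open>Each \<open>m\<close> up to \<open>N div n0\<close> has a multiple in the set, and each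
  element arises from at most \<open>n0\<close> values of \<open>m\<close>, one for each factor
  \<open>j\<close>. The factor 2 absorbs the rounding in \<open>N div n0\<close>.\<close>

lemma card_ge_of_multiples:
  fixes n0 N :: nat
  assumes "0 < n0" "n0 \<le> N" and P: "\<And>m. \<exists>j\<in>{1..n0}. P (j * m)"
  shows "N \<le> 2 * n0\<^sup>2 * card {n\<in>{1..N}. P n}"
proof -
  define A where "A = {n\<in>{1..N}. P n}"
  define q where "q = N div n0"
  have fA: "finite A" by (simp add: A_def)
  have "{1..q} \<subseteq> (\<Union>j\<in>{1..n0}. {m. j * m \<in> A})"
  proof
    fix m assume m: "m \<in> {1..q}"
    obtain j where j: "j \<in> {1..n0}" "P (j * m)" using P by blast
    have "j * m \<le> n0 * q" using j m by (intro mult_mono) auto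
    also have "\<dots> \<le> N" by (simp add: q_def)
    finally have "j * m \<le> N" .
    moreover have "1 \<le> j * m" using j m by simp
    ultimately show "m \<in> (\<Union>j\<in>{1..n0}. {m. j * m \<in> A})" using j unfolding A_def by auto
  qed
  moreover have inj: "inj_on ((*) j) {m. j * m \<in> A}" if "j \<in> {1..n0}" for j
    using that by (auto simp: inj_on_def)
  have fin: "finite {m. j * m \<in> A}" if "j \<in> {1..n0}" for j
    by (rule inj_on_finite[OF inj[OF that] _ fA]) auto
  have le: "card {m. j * m \<in> A} \<le> card A" if "j \<in> {1..n0}" for j
    using inj[OF that] fA by (intro card_inj_on_le) auto
  ultimately have "card {1..q} \<le> card (\<Union>j\<in>{1..n0}. {m. j * m \<in> A})"
    using fin by (intro card_mono) auto
  also have "\<dots> \<le> (\<Sum>j\<in>{1..n0}. card {m. j * m \<in> A})" by (intro card_UN_le) auto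
  also have "\<dots> \<le> n0 * card A" using sum_bounded_above[of "{1..n0}", OF le] by simp
  finally have q: "q \<le> n0 * card A" by simp
  have "1 \<le> q" using assms by (simp add: q_def div_greater_zero_iff Suc_le_eq)
  have "N = n0 * q + N mod n0" by (simp add: q_def)
  also have "\<dots> \<le> n0 * q + n0" using assms by (simp add: less_imp_le)
  also have "\<dots> \<le> 2 * (n0 * q)" using \<open>1 \<le> q\<close> by simp
  also have "\<dots> \<le> 2 * (n0 * (n0 * card A))" using q by (intro mult_left_mono) auto
  finally show ?thesis by (simp add: A_def power2_eq_square algebra_simps)
qed

section \<open>Sums over integer cubes\<close>

text \<open>For \<open>f = g\<close> this is the multiplicative derivative over the integers; two
  functions allow the base vertex to be treated separately.\<close>

definition twist :: "int \<Rightarrow> (int \<Rightarrow> complex) \<Rightarrow> (int \<Rightarrow> complex) \<Rightarrow> int \<Rightarrow> complex" where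
  "twist h g f = (\<lambda>x. g (x + h) * cnj (f x))"

text \<open>The product over the cube with base point \<open>x\<close> and sides \<open>hs\<close>, alternately conjugated, which
  carries \<open>f\<close> at \<open>x\<close> and \<open>g\<close> at all other vertices.\<close>

primrec cube_prod :: "int list \<Rightarrow> (int \<Rightarrow> complex) \<Rightarrow> (int \<Rightarrow> complex) \<Rightarrow> int \<Rightarrow> complex" where
  "cube_prod [] f g = f"
| "cube_prod (h # hs) f g = cube_prod hs (twist h g f) (twist h g g)"

text \<open>These sides are the differences of two points of \<open>{1..int N}\<close>; for
  functions supported there, any other side gives a zero product.\<close>

definition side_lists :: "nat \<Rightarrow> nat \<Rightarrow> int list set" where
  "side_lists N k = {hs. set hs \<subseteq> {- int N<..<int N} \<and> length hs = k}"

definition cube_sum :: "nat \<Rightarrow> nat \<Rightarrow> (int \<Rightarrow> complex) \<Rightarrow> (int \<Rightarrow> complex) \<Rightarrow> complex" where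
  "cube_sum N k f g = (\<Sum>hs\<in>side_lists N k. \<Sum>x\<in>{1..int N}. cube_prod hs f g x)"

definition supported :: "nat \<Rightarrow> (int \<Rightarrow> complex) \<Rightarrow> bool" where
  "supported N f \<longleftrightarrow> (\<forall>x. x \<notin> {1..int N} \<longrightarrow> f x = 0)"

lemma sum_lists_Suc:
  "(\<Sum>hs\<in>{hs. set hs \<subseteq> C \<and> length hs = Suc k}. F hs) =
   (\<Sum>h\<in>C. \<Sum>hs\<in>{hs. set hs \<subseteq> C \<and> length hs = k}. F (h # hs))"
proof -
  have "inj_on (\<lambda>(hs, h). h # hs) ({hs. set hs \<subseteq> C \<and> length hs = k} \<times> C)"
    by (auto simp: inj_on_def)
  then have "(\<Sum>hs\<in>{hs. set hs \<subseteq> C \<and> length hs = Suc k}. F hs) =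
      (\<Sum>(hs, h)\<in>{hs. set hs \<subseteq> C \<and> length hs = k} \<times> C. F (h # hs))"
    unfolding lists_length_Suc_eq by (subst sum.reindex) (auto simp: case_prod_unfold)
  also have "\<dots> = (\<Sum>hs\<in>{hs. set hs \<subseteq> C \<and> length hs = k}. \<Sum>h\<in>C. F (h # hs))"
    by (simp add: sum.cartesian_product)
  finally show ?thesis by (subst sum.swap)
qed

text \<open>Serves to pass from \<open>foldr\<close> in the norm to \<open>fold\<close>, which takes
  the head first as \<open>cube_prod\<close> does.\<close>

lemma sum_lists_rev:
  "(\<Sum>hs\<in>{hs. set hs \<subseteq> C \<and> length hs = k}. F (rev hs)) = (\<Sum>hs\<in>{hs. set hs \<subseteq> C \<and> length hs = k}. F hs)"
  by (rule sum.reindex_bij_witness[of _ rev rev]) auto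

lemma cube_sum_0: "cube_sum N 0 f g = (\<Sum>x\<in>{1..int N}. f x)"
proof -
  have "side_lists N 0 = {[]}" by (auto simp: side_lists_def)
  then show ?thesis by (simp add: cube_sum_def)
qed

lemma cube_sum_Suc:
  "cube_sum N (Suc k) f g = (\<Sum>h\<in>{- int N<..<int N}. cube_sum N k (twist h g f) (twist h g g))"
  unfolding cube_sum_def side_lists_def by (simp add: sum_lists_Suc)

lemma finite_side_lists: "finite (side_lists N k)"
  unfolding side_lists_def by (rule finite_lists_length_eq) simp

lemma card_sides_le: "card {- int N<..<int N} \<le> 2 * N"
  by simp

lemma card_side_lists_le: "card (side_lists N k) \<le> (2 * N) ^ k"
proof -
  have "card (side_lists N k) = card {- int N<..<int N} ^ k"
    unfolding side_lists_def by (rule card_lists_length_eq) simp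
  then show ?thesis using card_sides_le by (simp only: power_mono)
qed

lemma cube_prod_eq_0: "f x = 0 \<Longrightarrow> cube_prod hs f g x = 0"
  by (induction hs arbitrary: f g) (auto simp: twist_def)

lemma supported_cube_prod: "supported N f \<Longrightarrow> supported N (cube_prod hs f g)"
  unfolding supported_def using cube_prod_eq_0 by blast

lemma supported_twist: "supported N f \<Longrightarrow> supported N (twist h g f)"
  unfolding supported_def twist_def by auto

lemma twist_twist: "twist k (twist h v g) (twist h u f) = twist h (twist k v u) (twist k g f)"
  by (simp add: twist_def fun_eq_iff algebra_simps)

text \<open>By \<open>twist_twist\<close> the twist by \<open>h\<close> can be moved outermost,
  which splits the cube into its two faces in direction \<open>h\<close>.\<close>

lemma cube_prod_twist:
  "cube_prod hs (twist h u f) (twist h v g) x = cube_prod hs u v (x + h) * cnj (cube_prod hs f g x)"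
proof (induction hs arbitrary: u f v g)
  case Nil
  show ?case by (simp add: twist_def)
next
  case (Cons k hs)
  show ?case by (simp add: twist_twist Cons)
qed

lemma norm_cube_prod_le_1:
  assumes "\<And>x. cmod (f x) \<le> 1" "\<And>x. cmod (g x) \<le> 1"
  shows "cmod (cube_prod hs f g x) \<le> 1"
  using assms
proof (induction hs arbitrary: f g)
  case (Cons h hs)
  have "cmod (twist h u v y) \<le> 1" if "\<And>x. cmod (u x) \<le> 1" "\<And>x. cmod (v x) \<le> 1" for u v y
    using that by (simp add: twist_def norm_mult mult_le_one)
  then show ?case using Cons by simp
qed simp

lemma norm_cube_sum_le:
  assumes "\<And>x. cmod (f x) \<le> 1" "\<And>x. cmod (g x) \<le> 1"
  shows "cmod (cube_sum N k f g) \<le> real (2 * N) ^ Suc k"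
proof -
  have "cmod (cube_sum N k f g) \<le> (\<Sum>hs\<in>side_lists N k. real N)"
    unfolding cube_sum_def
  proof (rule sum_norm_le)
    fix hs
    have "cmod (\<Sum>x\<in>{1..int N}. cube_prod hs f g x) \<le> (\<Sum>x\<in>{1..int N}. 1)"
      using assms by (intro sum_norm_le norm_cube_prod_le_1) auto
    then show "cmod (\<Sum>x\<in>{1..int N}. cube_prod hs f g x) \<le> real N" by simp
  qed
  also have "\<dots> = real (card (side_lists N k)) * real N" by simp
  also have "\<dots> \<le> real ((2 * N) ^ k) * real (2 * N)"
    using card_side_lists_le[of N k] by (intro mult_mono) (auto simp del: of_nat_power of_nat_mult)
  finally show ?thesis by (simp add: mult.commute)
qed

definition base_sum :: "nat \<Rightarrow> int list \<Rightarrow> (int \<Rightarrow> complex) \<Rightarrow> complex" where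
  "base_sum N hs f = (\<Sum>x\<in>{1..int N}. cube_prod hs f f x)"

lemma cube_sum_base_sum: "cube_sum N k f f = (\<Sum>hs\<in>side_lists N k. base_sum N hs f)"
  by (simp add: cube_sum_def base_sum_def)

lemma sum_shift_supported:
  assumes "supported N F" "x \<in> {1..int N}"
  shows "(\<Sum>h\<in>{- int N<..<int N}. F (x + h)) = (\<Sum>y\<in>{1..int N}. F y)"
proof -
  have "(\<Sum>h\<in>{- int N<..<int N}. F (x + h)) = (\<Sum>y\<in>{x - int N<..<x + int N}. F y)"
    by (rule sum.reindex_bij_witness[of _ "\<lambda>y. y - x" "\<lambda>h. x + h"]) auto
  also have "\<dots> = (\<Sum>y\<in>{1..int N}. F y)"
    using assms unfolding supported_def by (intro sum.mono_neutral_right) auto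
  finally show ?thesis .
qed

text \<open>Summing over \<open>h\<close> makes the base point \<open>x + h\<close> of the upper
  face independent of \<open>x\<close>, so the two face sums decouple. For \<open>u = f\<close> this
  is a sum of squares, hence real and nonnegative.\<close>

lemma sum_cube_sum_twist:
  assumes "supported N u"
  shows "(\<Sum>h\<in>{- int N<..<int N}. cube_sum N k (twist h u f) (twist h u f)) =
    (\<Sum>hs\<in>side_lists N k. base_sum N hs u * cnj (base_sum N hs f))"
proof -
  have "(\<Sum>h\<in>{- int N<..<int N}. cube_sum N k (twist h u f) (twist h u f)) =
    (\<Sum>hs\<in>side_lists N k. \<Sum>h\<in>{- int N<..<int N}. \<Sum>x\<in>{1..int N}.
       cube_prod hs u u (x + h) * cnj (cube_prod hs f f x))"
    unfolding cube_sum_def cube_prod_twist by (rule sum.swap)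
  also have "\<dots> = (\<Sum>hs\<in>side_lists N k. \<Sum>x\<in>{1..int N}. \<Sum>h\<in>{- int N<..<int N}.
       cube_prod hs u u (x + h) * cnj (cube_prod hs f f x))"
    by (intro sum.cong refl sum.swap)
  also have "\<dots> = (\<Sum>hs\<in>side_lists N k. \<Sum>x\<in>{1..int N}. base_sum N hs u * cnj (cube_prod hs f f x))"
    using sum_shift_supported[OF supported_cube_prod[OF assms]]
    by (intro sum.cong refl) (simp add: base_sum_def flip: sum_distrib_right)
  finally show ?thesis by (simp add: base_sum_def sum_distrib_left)
qed

lemma cube_sum_Suc_eq:
  assumes "supported N f"
  shows "cube_sum N (Suc k) f f = of_real (\<Sum>hs\<in>side_lists N k. (cmod (base_sum N hs f))\<^sup>2)"
  unfolding cube_sum_Suc sum_cube_sum_twist[OF assms] by (simp flip: complex_norm_square)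

lemma cube_sum_Suc_norm:
  assumes "supported N f"
  shows "cube_sum N (Suc k) f f = of_real (cmod (cube_sum N (Suc k) f f))"
  unfolding cube_sum_Suc_eq[OF assms] norm_of_real by (simp add: sum_nonneg)

section \<open>Cauchy-Schwarz inequalities for cube sums\<close>

lemma norm_sum_cube_sum_twist_le:
  assumes "supported N u" "supported N f"
  shows "(cmod (\<Sum>h\<in>{- int N<..<int N}. cube_sum N k (twist h u f) (twist h u f)))\<^sup>2
    \<le> cmod (cube_sum N (Suc k) u u) * cmod (cube_sum N (Suc k) f f)"
proof -
  have "cmod (\<Sum>h\<in>{- int N<..<int N}. cube_sum N k (twist h u f) (twist h u f))
    \<le> (\<Sum>hs\<in>side_lists N k. cmod (base_sum N hs u) * cmod (base_sum N hs f))"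
    unfolding sum_cube_sum_twist[OF assms(1)] by (intro sum_norm_le) (simp add: norm_mult)
  then have "(cmod (\<Sum>h\<in>{- int N<..<int N}. cube_sum N k (twist h u f) (twist h u f)))\<^sup>2
    \<le> (\<Sum>hs\<in>side_lists N k. cmod (base_sum N hs u) * cmod (base_sum N hs f))\<^sup>2"
    by (intro power_mono) auto
  also have "\<dots> \<le> (\<Sum>hs\<in>side_lists N k. (cmod (base_sum N hs u))\<^sup>2) * (\<Sum>hs\<in>side_lists N k. (cmod (base_sum N hs f))\<^sup>2)"
    by (rule Cauchy_Schwarz_ineq_sum)
  also have "\<dots> = cmod (cube_sum N (Suc k) u u) * cmod (cube_sum N (Suc k) f f)"
    unfolding cube_sum_Suc_eq[OF assms(1)] cube_sum_Suc_eq[OF assms(2)] norm_of_real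
    by (simp add: sum_nonneg)
  finally show ?thesis .
qed

text \<open>Iterated Cauchy-Schwarz. \<open>W\<close> only bounds the cardinality, since there are
  \<open>2 * N - 1\<close> sides while the normalisation uses \<open>2 * N\<close>.\<close>

lemma power_mean_pow2:
  fixes t :: "'a \<Rightarrow> real"
  assumes "real (card I) \<le> W" "0 < W" "\<And>i. i \<in> I \<Longrightarrow> 0 \<le> t i"
  shows "((\<Sum>i\<in>I. t i) / W) ^ 2 ^ k \<le> (\<Sum>i\<in>I. t i ^ 2 ^ k) / W"
  using assms(3)
proof (induction k arbitrary: t)
  case 0
  show ?case by simp
next
  case (Suc k)
  have "((\<Sum>i\<in>I. t i) / W)\<^sup>2 \<le> ((\<Sum>i\<in>I. (t i)\<^sup>2) * card I) / W\<^sup>2"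
    using sum_squared_le_sum_of_squares[of t I] by (simp add: power_divide divide_right_mono)
  also have "\<dots> \<le> ((\<Sum>i\<in>I. (t i)\<^sup>2) * W) / W\<^sup>2"
    using assms by (intro divide_right_mono mult_left_mono) (auto intro: sum_nonneg)
  also have "\<dots> = (\<Sum>i\<in>I. (t i)\<^sup>2) / W" using assms(2) by (simp add: power2_eq_square)
  finally have "(((\<Sum>i\<in>I. t i) / W)\<^sup>2) ^ 2 ^ k \<le> ((\<Sum>i\<in>I. (t i)\<^sup>2) / W) ^ 2 ^ k"
    by (rule power_mono) simp
  also have "\<dots> \<le> (\<Sum>i\<in>I. ((t i)\<^sup>2) ^ 2 ^ k) / W" by (rule Suc.IH) simp
  finally show ?case by (simp flip: power_mult)
qed

lemma norm_sum_cube_sum_twist_normalised_le: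
  assumes "0 < N" "supported N f" "supported N g" "\<And>x. cmod (g x) \<le> 1"
  shows "(cmod (\<Sum>h\<in>{- int N<..<int N}. cube_sum N k (twist h g f) (twist h g f)) /
      real (2 * N) ^ Suc (Suc k))\<^sup>2
    \<le> cmod (cube_sum N (Suc k) f f) / real (2 * N) ^ Suc (Suc k)"
proof -
  define w where "w = real (2 * N) ^ Suc (Suc k)"
  have w: "w > 0" using assms(1) by (simp add: w_def)
  have "(cmod (\<Sum>h\<in>{- int N<..<int N}. cube_sum N k (twist h g f) (twist h g f)))\<^sup>2
      \<le> cmod (cube_sum N (Suc k) g g) * cmod (cube_sum N (Suc k) f f)"
    using assms by (intro norm_sum_cube_sum_twist_le)
  also have "\<dots> \<le> w * cmod (cube_sum N (Suc k) f f)"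
    unfolding w_def using assms(4) by (intro mult_right_mono norm_cube_sum_le) auto
  finally show ?thesis unfolding w_def[symmetric] using w
    by (simp add: power_divide power2_eq_square field_simps)
qed

text \<open>Gowers-Cauchy-Schwarz with \<open>f\<close> at one vertex and \<open>g\<close> at all
  others. For each first side \<open>h\<close>, the induction hypothesis replaces
  \<open>twist h g g\<close> by \<open>twist h g f\<close>; after averaging over \<open>h\<close>, a
  last Cauchy-Schwarz removes \<open>g\<close>.\<close>

lemma cube_sum_dual_bound:
  assumes "0 < N" "supported N f" "supported N g"
    and "\<And>x. cmod (f x) \<le> 1" "\<And>x. cmod (g x) \<le> 1"
  shows "(cmod (cube_sum N (Suc k) f g) / real (2 * N) ^ Suc (Suc k)) ^ 2 ^ Suc k
    \<le> cmod (cube_sum N (Suc k) f f) / real (2 * N) ^ Suc (Suc k)"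
  using assms(2-)
proof (induction k arbitrary: f g)
  case 0
  show ?case using norm_sum_cube_sum_twist_normalised_le[where k = 0, OF assms(1) 0(1,2,4)]
    by (simp add: cube_sum_Suc cube_sum_0)
next
  case (Suc k)
  have W: "real (2 * N) > 0" using assms(1) by simp
  define w where "w = real (2 * N) ^ Suc (Suc k)"
  define t where "t = (\<lambda>h. cmod (cube_sum N (Suc k) (twist h g f) (twist h g g)) / w)"
  have w: "w > 0" using W by (simp add: w_def)
  have tw: "cmod (twist h u v y) \<le> 1" if "\<And>x. cmod (u x) \<le> 1" "\<And>x. cmod (v x) \<le> 1" for h u v y
    using that by (simp add: twist_def norm_mult mult_le_one)
  have IH: "t h ^ 2 ^ Suc k \<le> cmod (cube_sum N (Suc k) (twist h g f) (twist h g f)) / w" for h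
    unfolding t_def w_def using Suc.prems by (intro Suc.IH supported_twist tw)
  have "cmod (cube_sum N (Suc (Suc k)) f g) / (real (2 * N) * w) \<le> (\<Sum>h\<in>{- int N<..<int N}. t h) / real (2 * N)"
    using norm_sum[of "\<lambda>h. cube_sum N (Suc k) (twist h g f) (twist h g g)" "{- int N<..<int N}"] W w
    by (simp add: cube_sum_Suc[of N "Suc k"] t_def divide_right_mono field_simps flip: sum_divide_distrib)
  then have "(cmod (cube_sum N (Suc (Suc k)) f g) / (real (2 * N) * w)) ^ 2 ^ Suc k
      \<le> ((\<Sum>h\<in>{- int N<..<int N}. t h) / real (2 * N)) ^ 2 ^ Suc k"
    using W w by (intro power_mono) auto
  also have "\<dots> \<le> (\<Sum>h\<in>{- int N<..<int N}. t h ^ 2 ^ Suc k) / real (2 * N)"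
    using W w card_sides_le[of N] by (intro power_mean_pow2) (auto simp: t_def)
  also have "\<dots> \<le> (\<Sum>h\<in>{- int N<..<int N}. cmod (cube_sum N (Suc k) (twist h g f) (twist h g f)) / w) / real (2 * N)"
    using W by (intro divide_right_mono sum_mono IH) auto
  \<comment> \<open>Nothing is lost here: by \<open>cube_sum_Suc_norm\<close> every summand is a
    nonnegative real.\<close>
  also have "\<dots> = cmod (\<Sum>h\<in>{- int N<..<int N}. cube_sum N (Suc k) (twist h g f) (twist h g f)) / (real (2 * N) * w)"
  proof -
    have "(\<Sum>h\<in>{- int N<..<int N}. cube_sum N (Suc k) (twist h g f) (twist h g f)) =
        of_real (\<Sum>h\<in>{- int N<..<int N}. cmod (cube_sum N (Suc k) (twist h g f) (twist h g f)))"
      unfolding of_real_sum using Suc.prems(1)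
      by (intro sum.cong refl cube_sum_Suc_norm supported_twist)
    then have "cmod (\<Sum>h\<in>{- int N<..<int N}. cube_sum N (Suc k) (twist h g f) (twist h g f)) =
        (\<Sum>h\<in>{- int N<..<int N}. cmod (cube_sum N (Suc k) (twist h g f) (twist h g f)))"
      by (simp only: norm_of_real abs_of_nonneg sum_nonneg norm_ge_zero)
    then show ?thesis by (simp add: field_simps flip: sum_divide_distrib)
  qed
  finally have "((cmod (cube_sum N (Suc (Suc k)) f g) / (real (2 * N) * w)) ^ 2 ^ Suc k)\<^sup>2
     \<le> (cmod (\<Sum>h\<in>{- int N<..<int N}. cube_sum N (Suc k) (twist h g f) (twist h g f)) / (real (2 * N) * w))\<^sup>2"
    using W w by (intro power_mono) auto
  also have "\<dots> \<le> cmod (cube_sum N (Suc (Suc k)) f f) / (real (2 * N) * w)"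
    using norm_sum_cube_sum_twist_normalised_le[where k = "Suc k", OF assms(1) Suc.prems(1,2,4)]
    by (simp add: w_def)
  finally show ?case by (simp add: w_def mult.commute flip: power_mult)
qed

text \<open>Monotonicity of Gowers norms: Cauchy-Schwarz against the constant 1 over at most
  \<open>(2 * N) ^ k\<close> side lists.\<close>

lemma cube_sum_growth:
  assumes "0 < N" "supported N f"
  shows "(cmod (cube_sum N k f f) / real (2 * N) ^ Suc k)\<^sup>2
    \<le> cmod (cube_sum N (Suc k) f f) / real (2 * N) ^ Suc (Suc k)"
proof -
  define W where "W = real (2 * N)"
  have W: "W > 0" using assms(1) by (simp add: W_def)
  have card: "real (card (side_lists N k)) \<le> W ^ k"
    using card_side_lists_le[of N k] unfolding W_def by (metis of_nat_le_iff of_nat_power)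
  have "(cmod (cube_sum N k f f))\<^sup>2 \<le> (\<Sum>hs\<in>side_lists N k. cmod (base_sum N hs f))\<^sup>2"
    unfolding cube_sum_base_sum by (intro power_mono norm_sum) auto
  also have "\<dots> \<le> (\<Sum>hs\<in>side_lists N k. (cmod (base_sum N hs f))\<^sup>2) * card (side_lists N k)"
    by (rule sum_squared_le_sum_of_squares)
  also have "(\<Sum>hs\<in>side_lists N k. (cmod (base_sum N hs f))\<^sup>2) = cmod (cube_sum N (Suc k) f f)"
    unfolding cube_sum_Suc_eq[OF assms(2)] norm_of_real by (simp add: sum_nonneg)
  also have "\<dots> * card (side_lists N k) \<le> cmod (cube_sum N (Suc k) f f) * W ^ k"
    using card by (intro mult_left_mono) auto
  finally have "(cmod (cube_sum N k f f))\<^sup>2 \<le> cmod (cube_sum N (Suc k) f f) * W ^ k" .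
  then have "(cmod (cube_sum N k f f))\<^sup>2 / (W ^ Suc k)\<^sup>2 \<le> (cmod (cube_sum N (Suc k) f f) * W ^ k) / (W ^ Suc k)\<^sup>2"
    by (intro divide_right_mono) auto
  also have "\<dots> = cmod (cube_sum N (Suc k) f f) / W ^ Suc (Suc k)"
    using W by (simp add: power2_eq_square)
  finally show ?thesis by (simp add: power_divide W_def)
qed

lemma cube_sum_growth_iter:
  assumes "0 < N" "supported N f" "0 \<le> C"
    and "C ^ 2 ^ k \<le> cmod (cube_sum N k f f) / real (2 * N) ^ Suc k" and "k \<le> l"
  shows "C ^ 2 ^ l \<le> cmod (cube_sum N l f f) / real (2 * N) ^ Suc l"
  using assms(5)
proof (induction l rule: dec_induct)
  case base
  show ?case by (rule assms(4))
next
  case (step l)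
  have "(C ^ 2 ^ l)\<^sup>2 \<le> (cmod (cube_sum N l f f) / real (2 * N) ^ Suc l)\<^sup>2"
    using step.IH assms(3) by (intro power_mono) auto
  also have "\<dots> \<le> cmod (cube_sum N (Suc l) f f) / real (2 * N) ^ Suc (Suc l)"
    using assms(1,2) by (rule cube_sum_growth)
  finally show ?case by (simp add: mult.commute flip: power_mult)
qed

text \<open>In the sum of squares from \<open>cube_sum_Suc_eq\<close>, the term with all sides 0 is
  already the square of \<open>N\<close>: on the interval the first twist turns \<open>f\<close>
  into 1, and the later ones keep it.\<close>

lemma cube_sum_trivial_bound:
  assumes "0 < N" "supported N f" "\<And>x. x \<in> {1..int N} \<Longrightarrow> cmod (f x) = 1"
  shows "1 \<le> cmod (cube_sum N (Suc (Suc k)) f f)"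
proof -
  define zs where "zs = replicate (Suc k) (0::int)"
  have "cube_prod (replicate k 0) g g x = 1" if "g x = 1" for g :: "int \<Rightarrow> complex" and x
    using that by (induction k arbitrary: g) (auto simp: twist_def)
  then have "cube_prod zs f f x = 1" if "x \<in> {1..int N}" for x
    using assms(3)[OF that] by (simp add: zs_def twist_def complex_norm_square[symmetric])
  then have "base_sum N zs f = of_nat N" by (simp add: base_sum_def)
  then have "1 \<le> (cmod (base_sum N zs f))\<^sup>2" using assms(1) by simp
  also have "\<dots> \<le> (\<Sum>hs\<in>side_lists N (Suc k). (cmod (base_sum N hs f))\<^sup>2)"
    using assms(1) finite_side_lists[of N "Suc k"]
    by (intro member_le_sum) (auto simp: zs_def side_lists_def)
  also have "\<dots> = cmod (cube_sum N (Suc (Suc k)) f f)"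
    unfolding cube_sum_Suc_eq[OF assms(2)] norm_of_real by (simp add: sum_nonneg)
  finally show ?thesis .
qed

section \<open>Gowers norms as cube sums\<close>

text \<open>No wraparound occurs: sides between \<open>- N\<close> and \<open>N\<close> are distinct
  modulo \<open>M\<close>, and every other residue has zero derivative. Derivatives stay supported
  on the interval, so the induction continues.\<close>

lemma sum_fold_mult_deriv:
  assumes "supported N f" "0 < N" "2 * N \<le> M"
  shows "(\<Sum>hs\<in>{hs. set hs \<subseteq> {0..<int M} \<and> length hs = k}. \<Sum>x\<in>{0..<int M}.
      fold (mult_deriv (integer_mod_group M)) hs f x) = cube_sum N k f f"
  using assms(1)
proof (induction k arbitrary: f)
  case 0
  have "{hs. set hs \<subseteq> {0..<int M} \<and> length hs = 0} = {[]}" by auto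
  moreover have "(\<Sum>x\<in>{0..<int M}. f x) = (\<Sum>x\<in>{1..int N}. f x)"
    using 0 assms(2,3) unfolding supported_def by (intro sum.mono_neutral_right) auto
  ultimately show ?case by (simp add: cube_sum_0)
next
  case (Suc k)
  define md where "md = (\<lambda>h. mult_deriv (integer_mod_group M) h f)"
  have md: "md h x = f ((x + h) mod int M) * cnj (f x)" for h x
    by (simp add: md_def mult_deriv_def)
  have sup: "supported N (md h)" for h using Suc.prems by (auto simp: supported_def md)
  have md_mod: "md (h mod int M) = twist h f f" if h: "h \<in> {- int N<..<int N}" for h
  proof
    fix x
    show "md (h mod int M) x = twist h f f x"
    proof (cases "x \<in> {1..int N}")
      case False
      then show ?thesis using Suc.prems by (auto simp: supported_def md twist_def)
    next
      case True
      have "f ((x + h) mod int M) = f (x + h)"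
      proof (cases "0 \<le> x + h")
        case True
        then show ?thesis using h \<open>x \<in> {1..int N}\<close> assms(3) by simp
      next
        case False
        \<comment> \<open>A negative \<open>x + h\<close> is at least \<open>2 - N\<close>, so
          adding \<open>M\<close> takes it beyond \<open>N\<close> and out of the support.\<close>
        have "(x + h) mod int M = (x + h + int M) mod int M" by simp
        also have "\<dots> = x + h + int M"
          using False h \<open>x \<in> {1..int N}\<close> assms(3) by (intro mod_pos_pos_trivial) auto
        finally have "(x + h) mod int M > int N" using h \<open>x \<in> {1..int N}\<close> assms(3) by auto
        then show ?thesis using False Suc.prems by (auto simp: supported_def)
      qed
      then show ?thesis by (simp add: md twist_def mod_add_right_eq)
    qed
  qed
  have inj: "inj_on (\<lambda>h. h mod int M) {- int N<..<int N}"
  proof (rule inj_onI)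
    fix a b assume ab: "a \<in> {- int N<..<int N}" "b \<in> {- int N<..<int N}" "a mod int M = b mod int M"
    then have "int M dvd a - b" by (simp add: mod_eq_dvd_iff)
    moreover have "\<bar>a - b\<bar> < int M" using ab assms(3) by auto
    ultimately show "a = b" using dvd_imp_le_int[of "a - b" "int M"] by fastforce
  qed
  have zero: "cube_sum N k (md h) (md h) = 0"
    if h: "h \<in> {0..<int M} - (\<lambda>h. h mod int M) ` {- int N<..<int N}" for h
  proof -
    have "md h x = 0" for x
    proof (rule ccontr)
      assume "md h x \<noteq> 0"
      then have "f x \<noteq> 0" "f ((x + h) mod int M) \<noteq> 0" by (auto simp: md)
      then have x: "x \<in> {1..int N}" "(x + h) mod int M \<in> {1..int N}"
        using Suc.prems unfolding supported_def by blast+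
      define g where "g = (x + h) mod int M - x"
      have "g mod int M = h" using h unfolding g_def by (simp add: mod_diff_left_eq)
      moreover have "g \<in> {- int N<..<int N}" using x unfolding g_def by auto
      ultimately show False using h by auto
    qed
    then show ?thesis by (simp add: cube_sum_def cube_prod_eq_0)
  qed
  have "(\<Sum>hs\<in>{hs. set hs \<subseteq> {0..<int M} \<and> length hs = Suc k}. \<Sum>x\<in>{0..<int M}.
      fold (mult_deriv (integer_mod_group M)) hs f x) = (\<Sum>h\<in>{0..<int M}. cube_sum N k (md h) (md h))"
    unfolding sum_lists_Suc using Suc.IH[OF sup] by (simp add: md_def)
  also have "\<dots> = (\<Sum>h\<in>(\<lambda>h. h mod int M) ` {- int N<..<int N}. cube_sum N k (md h) (md h))"
    using zero assms by (intro sum.mono_neutral_right) auto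
  also have "\<dots> = (\<Sum>h\<in>{- int N<..<int N}. cube_sum N k (twist h f f) (twist h f f))"
    using md_mod by (subst sum.reindex[OF inj]) simp
  finally show ?case by (simp add: cube_sum_Suc)
qed

lemma gowers_norm_eq_cube_sum:
  assumes "supported N f" "0 < N" "2 * N \<le> M"
  shows "gowers_norm (integer_mod_group M) k f = root (2 ^ k) (Re (cube_sum N k f f) / real M ^ (k + 1))"
proof -
  have car: "carrier (integer_mod_group M) = {0..<int M}"
    using assms by (simp add: carrier_integer_mod_group)
  have "(\<Sum>x\<in>{0..<int M}. \<Sum>hs\<in>{hs. set hs \<subseteq> {0..<int M} \<and> length hs = k}.
       foldr (mult_deriv (integer_mod_group M)) hs f x) =
     (\<Sum>x\<in>{0..<int M}. \<Sum>hs\<in>{hs. set hs \<subseteq> {0..<int M} \<and> length hs = k}.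
       fold (mult_deriv (integer_mod_group M)) hs f x)"
    using sum_lists_rev[where F = "\<lambda>hs. fold (mult_deriv (integer_mod_group M)) hs f _"]
    by (simp add: foldr_conv_fold)
  also have "\<dots> = cube_sum N k f f"
    using sum_fold_mult_deriv[OF assms] by (subst sum.swap) simp
  finally show ?thesis
    unfolding gowers_norm_def car by (simp flip: of_nat_power of_nat_mult power_Suc)
qed

text \<open>The powers of \<open>M\<close> cancel, leaving a root of a ratio of cube sums. The
  denominator is at least 1 by degenerate cubes and at most \<open>(2 * N) ^ Suc k\<close> by the
  trivial bound.\<close>

lemma gowers_norm_interval_ge:
  assumes "0 < N" "2 * N \<le> M" "2 \<le> k" "0 \<le> C"
    and C: "C ^ 2 ^ k \<le> cmod (cube_sum N k (extend_zero N f) (extend_zero N f)) / real (2 * N) ^ Suc k"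
  shows "C \<le> gowers_norm_interval M k N f"
proof -
  obtain l where k: "k = Suc (Suc l)" using assms(3) by (metis Suc_le_D numeral_2_eq_2 Suc_le_mono)
  have sup: "supported N (extend_zero N g)" for g
    by (auto simp: supported_def extend_zero_def)
  define s where "s = (\<lambda>g. cmod (cube_sum N k (extend_zero N g) (extend_zero N g)))"
  have norm: "gowers_norm (integer_mod_group M) k (extend_zero N g) = root (2 ^ k) (s g / real M ^ (k + 1))" for g
    unfolding gowers_norm_eq_cube_sum[OF sup assms(1,2)] s_def k
    using arg_cong[where f = Re, OF cube_sum_Suc_norm[OF sup[of g], of "Suc l"]] by simp
  have W: "real (2 * N) ^ Suc k > 0" using assms by simp
  define u :: "nat \<Rightarrow> complex" where "u = (\<lambda>_. 1)"
  have s1: "s u \<ge> 1"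
    unfolding s_def k u_def using assms(1) sup by (intro cube_sum_trivial_bound) (auto simp: extend_zero_def)
  have s2: "s u \<le> real (2 * N) ^ Suc k"
    unfolding s_def u_def by (intro norm_cube_sum_le) (auto simp: extend_zero_def)
  have "C = root (2 ^ k) (C ^ 2 ^ k)" using assms(4) by (simp add: real_root_power_cancel)
  also have "\<dots> \<le> root (2 ^ k) (s f / real (2 * N) ^ Suc k)"
    using C by (intro real_root_le_mono) (auto simp: s_def)
  also have "\<dots> \<le> root (2 ^ k) (s f / s u)"
    using s1 s2 W by (intro real_root_le_mono divide_left_mono mult_pos_pos) (auto simp: s_def)
  also have "s f / s u = (s f / real M ^ (k + 1)) / (s u / real M ^ (k + 1))"
    using assms(1,2) by simp
  also have "root (2 ^ k) \<dots> = gowers_norm_interval M k N f"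
    unfolding gowers_norm_interval_def norm u_def[symmetric] by (rule real_root_divide)
  finally show ?thesis .
qed

section \<open>Phases on cubes\<close>

primrec diffs :: "int list \<Rightarrow> (int \<Rightarrow> real) \<Rightarrow> int \<Rightarrow> real" where
  "diffs [] \<phi> = \<phi>"
| "diffs (h # hs) \<phi> = diffs hs (\<lambda>x. \<phi> (x + h) - \<phi> x)"

lemma diffs_snoc: "diffs (hs @ [h]) \<phi> x = diffs hs \<phi> (x + h) - diffs hs \<phi> x"
proof (induction hs arbitrary: \<phi>)
  case Nil
  show ?case by simp
next
  case (Cons k hs)
  show ?case by (simp add: Cons)
qed

lemma sum_nth_snoc:
  assumes "T \<subseteq> {..<length hs}"
  shows "(\<Sum>i\<in>T. (hs @ [h]) ! i) = (\<Sum>i\<in>T. hs ! i)"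
  using assms by (intro sum.cong) (auto simp: nth_append)

lemma sum_nth_snoc_insert:
  fixes h :: int
  assumes "T \<subseteq> {..<length hs}"
  shows "(\<Sum>i\<in>insert (length hs) T. (hs @ [h]) ! i) = h + (\<Sum>i\<in>T. hs ! i)"
proof -
  have "finite T" "length hs \<notin> T" using assms finite_subset by auto
  then show ?thesis using sum_nth_snoc[OF assms, of h] by simp
qed

text \<open>Induction from the end of the list keeps the indices of the earlier sides fixed; the
  last side becomes the new element \<open>n\<close>.\<close>

lemma diffs_altsum:
  "diffs hs \<phi> x = (- 1) ^ length hs * altsum (\<lambda>T. \<phi> (x + (\<Sum>i\<in>T. hs ! i))) {..<length hs}"
proof (induction hs arbitrary: x rule: rev_induct)
  case Nil
  show ?case by (simp add: altsum_def)
next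
  case (snoc h hs)
  define n where "n = length hs"
  have cong: "altsum F {..<n} = altsum G {..<n}" if "\<And>T. T \<subseteq> {..<n} \<Longrightarrow> F T = G T" for F G
    unfolding altsum_def using that by (intro sum.cong) auto
  have "altsum (\<lambda>T. \<phi> (x + (\<Sum>i\<in>T. (hs @ [h]) ! i))) {..<Suc n} =
      altsum (\<lambda>T. \<phi> (x + (\<Sum>i\<in>T. (hs @ [h]) ! i))) {..<n} -
      altsum (\<lambda>T. \<phi> (x + (\<Sum>i\<in>insert n T. (hs @ [h]) ! i))) {..<n}"
    by (simp add: lessThan_Suc altsum_insert)
  also have "\<dots> = altsum (\<lambda>T. \<phi> (x + (\<Sum>i\<in>T. hs ! i))) {..<n} - altsum (\<lambda>T. \<phi> (x + h + (\<Sum>i\<in>T. hs ! i))) {..<n}"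
    by (intro arg_cong2[where f = "(-)"] cong)
      (simp_all add: n_def sum_nth_snoc sum_nth_snoc_insert add.assoc)
  finally have split: "altsum (\<lambda>T. \<phi> (x + (\<Sum>i\<in>T. (hs @ [h]) ! i))) {..<Suc n} =
      altsum (\<lambda>T. \<phi> (x + (\<Sum>i\<in>T. hs ! i))) {..<n} - altsum (\<lambda>T. \<phi> (x + h + (\<Sum>i\<in>T. hs ! i))) {..<n}" .
  have len: "length (hs @ [h]) = Suc n" by (simp add: n_def)
  show ?case unfolding len split by (simp add: diffs_snoc snoc.IH n_def right_diff_distrib)
qed

lemma e2pi_cis: "e2pi x = cis (2 * pi * x)"
  by (simp add: e2pi_def cis_conv_exp mult_ac)

lemma e2pi_add: "e2pi (x + y) = e2pi x * e2pi y"
  by (simp add: e2pi_cis cis_mult distrib_left)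

lemma cnj_e2pi: "cnj (e2pi x) = e2pi (- x)"
  by (simp add: e2pi_cis cis_cnj)

lemma e2pi_diff: "e2pi (x - y) = e2pi x * cnj (e2pi y)"
  using e2pi_add[of x "- y"] by (simp add: cnj_e2pi)

lemma e2pi_0: "e2pi 0 = 1"
  by (simp add: e2pi_cis)

lemma norm_e2pi: "cmod (e2pi x) = 1"
  by (simp add: e2pi_cis)

lemma cube_prod_phase:
  "cube_prod hs (\<lambda>x. a x * e2pi (\<phi> x)) (\<lambda>x. b x * e2pi (\<phi> x)) x = cube_prod hs a b x * e2pi (diffs hs \<phi> x)"
proof (induction hs arbitrary: a b \<phi>)
  case Nil
  show ?case by simp
next
  case (Cons h hs)
  have "twist h (\<lambda>x. b x * e2pi (\<phi> x)) (\<lambda>x. a x * e2pi (\<phi> x)) =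
      (\<lambda>x. twist h b a x * e2pi (\<phi> (x + h) - \<phi> x))" for a b
    by (simp add: twist_def fun_eq_iff e2pi_diff)
  then show ?case by (simp add: Cons)
qed

definition ind :: "int set \<Rightarrow> int \<Rightarrow> complex" where
  "ind X x = of_bool (x \<in> X)"

text \<open>The base points in \<open>X\<close> of cubes with the given sides whose other vertices
  all lie in \<open>Y\<close>.\<close>

primrec cube_set :: "int list \<Rightarrow> int set \<Rightarrow> int set \<Rightarrow> int set" where
  "cube_set [] X Y = X"
| "cube_set (h # hs) X Y = cube_set hs {x\<in>X. x + h \<in> Y} {x\<in>Y. x + h \<in> Y}"

lemma cube_prod_ind: "cube_prod hs (ind X) (ind Y) = ind (cube_set hs X Y)"
proof (induction hs arbitrary: X Y)
  case (Cons h hs)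
  have "twist h (ind Y) (ind X) = ind {x\<in>X. x + h \<in> Y}" for X Y
    by (auto simp: twist_def ind_def fun_eq_iff)
  then show ?case by (simp add: Cons)
qed simp

lemma cube_set_mono: "X \<subseteq> X' \<Longrightarrow> cube_set hs X Y \<subseteq> cube_set hs X' Y"
proof (induction hs arbitrary: X X' Y)
  case (Cons h hs)
  have "{x\<in>X. x + h \<in> Y} \<subseteq> {x\<in>X'. x + h \<in> Y}" using Cons.prems by auto
  then show ?case using Cons.IH by simp
qed simp

lemma cube_set_snoc: "cube_set (hs @ [h]) X Y = {x\<in>cube_set hs X Y. x + h \<in> cube_set hs Y Y}"
  by (induction hs arbitrary: X Y) auto

lemma cube_set_vertices:
  assumes "x \<in> cube_set hs X Y"
  shows "x \<in> X" "\<And>T. T \<subseteq> {..<length hs} \<Longrightarrow> T \<noteq> {} \<Longrightarrow> x + (\<Sum>i\<in>T. hs ! i) \<in> Y"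
proof -
  have "x \<in> X \<and> (\<forall>T\<subseteq>{..<length hs}. T \<noteq> {} \<longrightarrow> x + (\<Sum>i\<in>T. hs ! i) \<in> Y)"
    using assms
  proof (induction hs arbitrary: x X rule: rev_induct)
    case Nil
    then show ?case by simp
  next
    case (snoc h hs)
    define n where "n = length hs"
    have x: "x \<in> cube_set hs X Y" "x + h \<in> cube_set hs Y Y" using snoc.prems by (auto simp: cube_set_snoc)
    have "x + (\<Sum>i\<in>T. (hs @ [h]) ! i) \<in> Y" if T: "T \<subseteq> {..<Suc n}" "T \<noteq> {}" for T
    proof (cases "n \<in> T")
      case False
      then have "T \<subseteq> {..<n}" using T by (auto simp: less_Suc_eq)
      then show ?thesis using snoc.IH[OF x(1)] T(2) by (simp add: sum_nth_snoc n_def)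
    next
      case True
      define R where "R = T - {n}"
      have R: "R \<subseteq> {..<n}" "T = insert n R" using T True by (auto simp: R_def less_Suc_eq)
      \<comment> \<open>For empty \<open>R\<close> this vertex is the base point of the upper face,
        covered by the first half of the claim with \<open>X = Y\<close>.\<close>
      have "x + h + (\<Sum>i\<in>R. hs ! i) \<in> Y"
        using snoc.IH[OF x(2)] R(1) by (cases "R = {}") (auto simp: n_def)
      then show ?thesis using R by (simp add: sum_nth_snoc_insert n_def add.assoc)
    qed
    then show ?case using snoc.IH[OF x(1)] by (simp add: n_def)
  qed
  then show "x \<in> X" "\<And>T. T \<subseteq> {..<length hs} \<Longrightarrow> T \<noteq> {} \<Longrightarrow> x + (\<Sum>i\<in>T. hs ! i) \<in> Y" by auto
qed

text \<open>The phase is trivial on every contributing cube, so the mixed sum counts cubes with base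
  in the interval and other vertices in \<open>A\<close>, among them all cubes inside
  \<open>A\<close>.\<close>

lemma norm_cube_sum_phase_ge:
  assumes A: "A \<subseteq> {1..int N}"
    and zero: "\<And>hs x. length hs = k \<Longrightarrow> x \<in> cube_set hs {1..int N} A \<Longrightarrow> diffs hs \<phi> x = 0"
  shows "cmod (cube_sum N k (ind A) (ind A)) \<le>
    cmod (cube_sum N k (\<lambda>x. ind {1..int N} x * e2pi (\<phi> x)) (\<lambda>x. ind A x * e2pi (\<phi> x)))"
proof -
  define c where "c = (\<lambda>X. \<Sum>hs\<in>side_lists N k. \<Sum>x\<in>{1..int N}. of_bool (x \<in> cube_set hs X A) :: real)"
  have "cube_sum N k (ind A) (ind A) = of_real (c A)"
    by (simp add: cube_sum_def cube_prod_ind ind_def c_def)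
  moreover have "cube_sum N k (\<lambda>x. ind {1..int N} x * e2pi (\<phi> x)) (\<lambda>x. ind A x * e2pi (\<phi> x)) = of_real (c {1..int N})"
    unfolding cube_sum_def c_def of_real_sum
  proof (intro sum.cong refl)
    fix hs x assume "hs \<in> side_lists N k"
    then have "length hs = k" by (simp add: side_lists_def)
    then show "cube_prod hs (\<lambda>x. ind {1..int N} x * e2pi (\<phi> x)) (\<lambda>x. ind A x * e2pi (\<phi> x)) x =
        of_real (of_bool (x \<in> cube_set hs {1..int N} A))"
      unfolding cube_prod_phase cube_prod_ind using zero by (auto simp: ind_def e2pi_0)
  qed
  moreover have "0 \<le> c A" unfolding c_def by (intro sum_nonneg) auto
  moreover have "c A \<le> c {1..int N}"
    unfolding c_def using cube_set_mono[OF A] by (intro sum_mono) auto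
  ultimately show ?thesis by simp
qed

section \<open>The lower bound for bracket phases\<close>

lemma cube_sum_realise_ge:
  assumes cf: "constant_free \<Phi>" and deg: "degree_at_most \<Phi> d" and d: "1 \<le> d"
  shows "\<exists>C>0. \<forall>N \<alpha>. 1 \<le> N \<longrightarrow>
    C ^ 2 ^ Suc d \<le> cmod (cube_sum N (Suc d) (extend_zero N (\<lambda>n. e2pi (realise \<alpha> \<Phi> n)))
      (extend_zero N (\<lambda>n. e2pi (realise \<alpha> \<Phi> n)))) / real (2 * N) ^ Suc (Suc d)"
proof -
  obtain n0 where n0: "n0 > 0"
    "\<And>\<alpha> m. \<exists>j\<in>{1..n0}. \<forall>\<Psi>\<in>fracs \<Phi>. \<bar>sfrac (realise \<alpha> \<Psi> (j * m))\<bar> \<le> 1 / 2 ^ (d + 3)"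
    using bracket_recurrence[OF cf deg] by blast
  \<comment> \<open>Lower bound for \<open>card A / (2 * N)\<close> that follows from
    \<open>card_ge_of_multiples\<close>.\<close>
  define \<delta> where "\<delta> = 1 / (4 * real n0 ^ 2)"
  \<comment> \<open>The first term serves \<open>n0 \<le> N\<close>, where growth and duality each
    cost a power \<open>2 ^ Suc d\<close>. The second serves smaller \<open>N\<close>, where
    degenerate cubes contribute at least 1.\<close>
  define C where "C = min (\<delta> ^ 2 ^ Suc d) (1 / (2 * real n0) ^ Suc (Suc d))"
  have del: "0 < \<delta>" using n0 by (simp add: \<delta>_def)
  have Cpos: "C > 0" using del n0 by (simp add: C_def)
  have "C ^ 2 ^ Suc d \<le> cmod (cube_sum N (Suc d) (extend_zero N (\<lambda>n. e2pi (realise \<alpha> \<Phi> n)))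
      (extend_zero N (\<lambda>n. e2pi (realise \<alpha> \<Phi> n)))) / real (2 * N) ^ Suc (Suc d)" (is "_ \<le> ?R")
    if N: "1 \<le> N" for N \<alpha>
  proof -
    define \<phi> where "\<phi> = (\<lambda>x. realise \<alpha> \<Phi> (nat x))"
    define f where "f = (\<lambda>x. ind {1..int N} x * e2pi (\<phi> x))"
    have f: "extend_zero N (\<lambda>n. e2pi (realise \<alpha> \<Phi> n)) = f"
      by (auto simp: fun_eq_iff extend_zero_def f_def ind_def \<phi>_def)
    have sf: "supported N f" and bf: "\<And>x. cmod (f x) \<le> 1"
      by (auto simp: supported_def f_def ind_def norm_mult norm_e2pi)
    have W: "real (2 * N) ^ Suc (Suc d) > 0" and N0: "0 < N" using N by simp_all
    have "C ^ 2 ^ Suc d \<le> cmod (cube_sum N (Suc d) f f) / real (2 * N) ^ Suc (Suc d)"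
    proof (cases "n0 \<le> N")
      case False
      have C1: "C \<le> 1 / (2 * real n0) ^ Suc (Suc d)" by (simp add: C_def)
      also have "\<dots> \<le> 1"
      proof -
        have "1 / y \<le> 1" if "1 \<le> y" for y :: real using that by simp
        moreover have "1 \<le> (2 * real n0) ^ Suc (Suc d)" using n0(1) by (intro one_le_power) auto
        ultimately show ?thesis by blast
      qed
      finally have "C ^ 2 ^ Suc d \<le> C ^ 1" using Cpos by (intro power_decreasing) auto
      also have "C ^ 1 \<le> 1 / (2 * real n0) ^ Suc (Suc d)" using C1 by simp
      also have "\<dots> \<le> 1 / real (2 * N) ^ Suc (Suc d)"
        using False N by (intro divide_left_mono power_mono mult_pos_pos zero_less_power) auto
      also have "\<dots> \<le> cmod (cube_sum N (Suc d) f f) / real (2 * N) ^ Suc (Suc d)"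
      proof (rule divide_right_mono)
        obtain l where l: "d = Suc l" using d by (cases d) auto
        show "1 \<le> cmod (cube_sum N (Suc d) f f)"
          unfolding l using N sf
          by (intro cube_sum_trivial_bound) (auto simp: f_def ind_def norm_mult norm_e2pi)
      qed (use W in simp)
      finally show ?thesis .
    next
      case True
      define P where "P = (\<lambda>n. \<forall>\<Psi>\<in>fracs \<Phi>. \<bar>sfrac (realise \<alpha> \<Psi> n)\<bar> \<le> 1 / 2 ^ (d + 3))"
      define A where "A = {x\<in>{1..int N}. P (nat x)}"
      define g where "g = (\<lambda>x. ind A x * e2pi (\<phi> x))"
      have AN: "A \<subseteq> {1..int N}" by (auto simp: A_def)
      have sg: "supported N g" and bg: "\<And>x. cmod (g x) \<le> 1" and sA: "supported N (ind A)"
        using AN by (auto simp: supported_def g_def ind_def norm_mult norm_e2pi)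
      have "A = int ` {n\<in>{1..N}. P n}"
      proof
        show "A \<subseteq> int ` {n\<in>{1..N}. P n}"
        proof
          fix x assume "x \<in> A"
          then show "x \<in> int ` {n\<in>{1..N}. P n}" by (intro image_eqI[of _ _ "nat x"]) (auto simp: A_def)
        qed
      qed (auto simp: A_def)
      then have "card A = card {n\<in>{1..N}. P n}" by (simp add: card_image)
      then have "N \<le> 2 * n0\<^sup>2 * card A"
        using card_ge_of_multiples[OF n0(1) True, of P] n0(2) unfolding P_def by simp
      then have "real N \<le> real (2 * n0\<^sup>2 * card A)" by (simp only: of_nat_le_iff)
      then have dA: "\<delta> \<le> real (card A) / real (2 * N)"
        using N n0(1) by (simp add: \<delta>_def field_simps)
      have "cmod (cube_sum N 0 (ind A) (ind A)) = real (card A)"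
      proof -
        have "cube_sum N 0 (ind A) (ind A) = (\<Sum>x\<in>A. 1)"
          unfolding cube_sum_0 using AN by (intro sum.mono_neutral_cong_right) (auto simp: ind_def)
        then show ?thesis by simp
      qed
      \<comment> \<open>In dimension 0 the cube sum is \<open>card A\<close>; repeated
        Cauchy-Schwarz climbs from there to dimension \<open>Suc d\<close>.\<close>
      then have "\<delta> ^ 2 ^ 0 \<le> cmod (cube_sum N 0 (ind A) (ind A)) / real (2 * N) ^ Suc 0"
        using dA by simp
      then have "\<delta> ^ 2 ^ Suc d \<le> cmod (cube_sum N (Suc d) (ind A) (ind A)) / real (2 * N) ^ Suc (Suc d)"
        by (rule cube_sum_growth_iter[OF N0 sA less_imp_le[OF del] _ le0])
      also have "\<dots> \<le> cmod (cube_sum N (Suc d) f g) / real (2 * N) ^ Suc (Suc d)"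
      proof (rule divide_right_mono)
        show "cmod (cube_sum N (Suc d) (ind A) (ind A)) \<le> cmod (cube_sum N (Suc d) f g)"
          unfolding f_def g_def
        proof (rule norm_cube_sum_phase_ge[OF AN])
          fix hs x assume hs: "length hs = Suc d" and x: "x \<in> cube_set hs {1..int N} A"
          define p where "p = (\<lambda>T. x + (\<Sum>i\<in>T. hs ! i))"
          have pA: "p T \<in> A" if "T \<subseteq> {..<Suc d}" "T \<noteq> {}" for T
            using cube_set_vertices(2)[OF x] that unfolding hs p_def by blast
          have pN: "p T \<in> {1..int N}" if "T \<subseteq> {..<Suc d}" for T
            using pA[OF that] AN cube_set_vertices(1)[OF x] by (cases "T = {}") (auto simp: p_def)
          \<comment> \<open>The base \<open>p {}\<close> need not lie in \<open>A\<close>; small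
            brackets at the other vertices are enough.\<close>
          have "altsum (\<lambda>T. realise \<alpha> \<Phi> (nat (p T))) {..<Suc d} = 0"
          proof (rule altsum_realise_eq_0[OF _ _ _ deg])
            show "real (nat (p T)) = of_int x + (\<Sum>i\<in>T. of_int (hs ! i))" if "T \<subseteq> {..<Suc d}" for T
              using pN[OF that] by (simp add: p_def)
            show "\<bar>sfrac (realise \<alpha> \<Psi> (nat (p T)))\<bar> \<le> 1 / 2 ^ (d + 3)"
              if "\<Psi> \<in> fracs \<Phi>" "T \<subseteq> {..<Suc d}" "T \<noteq> {}" for \<Psi> T
              using pA[OF that(2,3)] that(1) by (simp add: A_def P_def)
          qed auto
          then show "diffs hs \<phi> x = 0" by (simp add: diffs_altsum hs \<phi>_def p_def)
        qed
      qed (use W in simp)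
      finally have "(\<delta> ^ 2 ^ Suc d) ^ 2 ^ Suc d \<le> (cmod (cube_sum N (Suc d) f g) / real (2 * N) ^ Suc (Suc d)) ^ 2 ^ Suc d"
        using del by (intro power_mono) auto
      also have "\<dots> \<le> cmod (cube_sum N (Suc d) f f) / real (2 * N) ^ Suc (Suc d)"
        by (rule cube_sum_dual_bound[OF N0 sf sg bf bg])
      finally have "(\<delta> ^ 2 ^ Suc d) ^ 2 ^ Suc d \<le> cmod (cube_sum N (Suc d) f f) / real (2 * N) ^ Suc (Suc d)" .
      moreover have "C ^ 2 ^ Suc d \<le> (\<delta> ^ 2 ^ Suc d) ^ 2 ^ Suc d"
        using Cpos by (intro power_mono) (auto simp: C_def)
      ultimately show ?thesis by linarith
    qed
    then show ?thesis unfolding f .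
  qed
  then show ?thesis using Cpos by blast
qed

theorem theorem2p8:
  fixes \<Phi> :: bracket_form
  assumes "constant_free \<Phi>"
  shows "\<exists>c::real. c > 0 \<and>
    (\<forall>k::nat. k \<ge> 2 \<longrightarrow> degree_at_most \<Phi> (k - 1) \<longrightarrow>
      (\<forall>(N::nat) (M::nat) (\<alpha>::nat \<Rightarrow> real). N \<ge> 1 \<longrightarrow> M \<ge> 2 ^ k * N \<longrightarrow>
        gowers_norm_interval M k N (\<lambda>n. e2pi (realise \<alpha> \<Phi> n)) \<ge> c))"
proof (cases "\<exists>d\<ge>1. degree_at_most \<Phi> d")
  \<comment> \<open>No \<open>k\<close> qualifies, so any positive constant works.\<close>
  case False
  then have "\<not> degree_at_most \<Phi> (k - 1)" if "k \<ge> 2" for k using that by (simp add: le_diff_conv2)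
  then show ?thesis by (intro exI[of _ 1]) auto
next
  case True
  \<comment> \<open>With the least such \<open>d\<close>, every admissible \<open>k\<close>
    satisfies \<open>Suc d \<le> k\<close>. The bound in dimension \<open>Suc d\<close> then carries
    over with the same \<open>C\<close>, which keeps the constant independent of
    \<open>k\<close>.\<close>
  define d where "d = (LEAST d. 1 \<le> d \<and> degree_at_most \<Phi> d)"
  have d: "1 \<le> d" "degree_at_most \<Phi> d"
    using LeastI_ex[of "\<lambda>d. 1 \<le> d \<and> degree_at_most \<Phi> d"] True unfolding d_def by auto
  obtain C where C: "C > 0" "\<And>N \<alpha>. 1 \<le> N \<Longrightarrow>
    C ^ 2 ^ Suc d \<le> cmod (cube_sum N (Suc d) (extend_zero N (\<lambda>n. e2pi (realise \<alpha> \<Phi> n)))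
      (extend_zero N (\<lambda>n. e2pi (realise \<alpha> \<Phi> n)))) / real (2 * N) ^ Suc (Suc d)"
    using cube_sum_realise_ge[OF assms d(2,1)] by blast
  have "C \<le> gowers_norm_interval M k N (\<lambda>n. e2pi (realise \<alpha> \<Phi> n))"
    if k: "k \<ge> 2" "degree_at_most \<Phi> (k - 1)" and N: "N \<ge> 1" and M: "M \<ge> 2 ^ k * N" for k N M \<alpha>
  proof -
    have "d \<le> k - 1" unfolding d_def using k by (intro Least_le) auto
    then have dk: "Suc d \<le> k" using k by simp
    have "(2::nat) ^ 1 \<le> 2 ^ k" using k by (intro power_increasing) auto
    then have "2 * N \<le> 2 ^ k * N" by simp
    then have M2: "2 * N \<le> M" using M by linarith
    show ?thesis
    proof (rule gowers_norm_interval_ge[OF _ M2 k(1)])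
      show "C ^ 2 ^ k \<le> cmod (cube_sum N k (extend_zero N (\<lambda>n. e2pi (realise \<alpha> \<Phi> n)))
          (extend_zero N (\<lambda>n. e2pi (realise \<alpha> \<Phi> n)))) / real (2 * N) ^ Suc k"
        using N C(1) by (intro cube_sum_growth_iter[OF _ _ _ C(2)[OF N] dk])
          (auto simp: supported_def extend_zero_def)
    qed (use N C(1) in auto)
  qed
  then show ?thesis using C(1) by blast
qed

end
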